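(* Consider a hybrid transmission grid satisfying the system model and the standing assumptions described in the context, with associated OPF problem $$\min_{\bm v\in\mathbb C^{N_V},\,\bm p\in\mathbb R^{N_D}}\ \bm v^{H}\bm C_0\bm v+\bm c_0^{T}\bm p\quad\text{s.t.}\quad \bm v^{H}\bm C_m\bm v+\bm c_m^{T}\bm p\le b_m,\ m=1,\dots,M,$$ and its semidefinite relaxation $$\min_{\bm V\in\mathbb S^{N_V},\,\bm p\in\mathbb R^{N_D}}\ \operatorname{tr}(\bm C_0\bm V)+\bm c_0^{T}\bm p\quad\text{s.t.}\quad \operatorname{tr}(\bm C_m\bm V)+\bm c_m^{T}\bm p\le b_m,\ m=1,\dots,M,\quad \bm V\succeq \bm 0 .$$ Assume strict feasibility: there exist $\bm v\in\mathbb C^{N_V}$ and $\bm p\in\mathbb R_+^{N_D}$ such that constraints (1)--(11) listed in the context hold with strict inequality and constraints (12) and (13) hold componentwise, each component either strictly or with equality. Assume moreover that the relaxation has no feasible point $(\bm V,\bm p)$ with $\bm V=\bm 0$. Then the relaxation is exact, i.e., every optimizer $(\bm V^\star,\bm p^\star)$ of the relaxation satisfies $\operatorname{rank}(\bm V^\star)=1$.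
   Context: Notation: $\mathbb R_+$ is the set of nonnegative reals, $\mathbb S^N$ the set of Hermitian $N\times N$ matrices, $\mathbf i$ the imaginary unit, $x^*$ complex conjugate, $(\cdot)^T$ transpose, $(\cdot)^H$ conjugate transpose, $\arg(\cdot)\in(-\pi,\pi]$ the principal argument, $\bm e_n$ the $n$th standard basis vector of appropriate dimension. Grid: $\mathcal V=\{1,\dots,N_V\}$ (buses), $\mathcal E=\{1,\dots,N_E\}$ (AC branches), $\mathcal D=\{1,\dots,N_D\}$ (DC branches), with maps $\hat\epsilon,\check\epsilon:\mathcal E\to\mathcal V$ (source and destination bus of an AC branch) and $\hat\delta,\check\delta:\mathcal D\to\mathcal V$ (source and destination bus of a DC branch). Assumed: $\hat\epsilon(k)\ne\check\epsilon(k)$ for all $k\in\mathcal E$ and $\hat\delta(l)\neq\check\delta(l)$ for all $l\in\mathcal D$; there are no distinct $k_1,k_2\in\mathcal E$ with $(\hat\epsilon(k_1),\check\epsilon(k_1))=(\hat\epsilon(k_2),\check\epsilon(k_2))$ or with $(\hat\epsilon(k_1),\check\epsilon(k_1))=(\check\epsilon(k_2),\hat\epsilon(k_2))$; and the undirected graph $\bar{\mathcal G}_{AC}=(\mathcal V,\bar{\mathcal E})$ with $\bar{\mathcal E}=\bigcup_{k\in\mathcal E}\{(\hat\epsilon(k),\check\epsilon(k)),(\check\epsilon(k),\hat\epsilon(k))\}$ is a tree (connected and acyclic). Parameters of AC branch $k\in\mathcal E$: series admittance $\bar y_k\in\mathbb C$, shunt admittances $\hat y_k,\check y_k\in\mathbb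 C$, voltage ratios $\hat\rho_k,\check\rho_k\in\mathbb C\setminus\{0\}$, and $\rho_k=\hat\rho_k^*\check\rho_k$. Assumed for all $k$: $\operatorname{Re}(\bar y_k)>0$, $\operatorname{Re}(\hat y_k)\ge0$, $\operatorname{Re}(\check y_k)\ge0$, $\operatorname{Im}(\bar y_k)\le0$, $|\hat y_k|\le|\bar y_k|$, $|\check y_k|\le|\bar y_k|$, $|\arg(\rho_k)|\le\pi/2$. Each bus $n$ has a shunt admittance $\tilde y_n\in\mathbb C$; each DC branch $l$ has a loss factor $\eta_l\in[0,1)$. Define $\hat\alpha_k=|\hat\rho_k|^2(\bar y_k+\hat y_k)$, $\hat\beta_k=-\rho_k\bar y_k$, $\check\alpha_k=|\check\rho_k|^2(\bar y_k+\check y_k)$, $\check\beta_k=-\rho_k^*\bar y_k$; $\hat{\bm Y}=\sum_{k\in\mathcal E}\bm e_k(\hat\alpha_k\bm e_{\hat\epsilon(k)}^T+\hat\beta_k\bm e_{\check\epsilon(k)}^T)$ and $\check{\bm Y}=\sum_{k\in\mathcal E}\bm e_k(\check\alpha_k\bm e_{\check\epsilon(k)}^T+\check\beta_k\bm e_{\hat\epsilon(k)}^T)$ in $\mathbb C^{N_E\times N_V}$; $\bm Y=\sum_{n\in\mathcal V}\bm e_n\big[\alpha_n\bm e_n^T+\sum_{k:\hat\epsilon(k)=n}\hat\beta_k\bm e_{\check\epsilon(k)}^T+\sum_{k:\check\epsilon(k)=n}\check\beta_k\bm e_{\hat\epsilon(k)}^T\big]\in\mathbb C^{N_V\times N_V}$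 with $\alpha_n=\tilde y_n+\sum_{k:\hat\epsilon(k)=n}\hat\alpha_k+\sum_{k:\check\epsilon(k)=n}\check\alpha_k$. Matrices: $\bm S_n=\bm Y^H\bm e_n\bm e_n^T$, $\bm P_n=(\bm S_n+\bm S_n^H)/2$, $\bm Q_n=(\bm S_n-\bm S_n^H)/(2\mathbf i)$, $\bm M_n=\bm e_n\bm e_n^T$ for $n\in\mathcal V$, and $\bm h_n=\sum_{l:\hat\delta(l)=n}\bm e_l-\sum_{l:\check\delta(l)=n}(1-\eta_l)\bm e_l\in\mathbb R^{N_D}$. For $k\in\mathcal E$: $\hat{\bm I}_k=\hat{\bm Y}^H\bm e_k\bm e_k^T\hat{\bm Y}$, $\check{\bm I}_k=\check{\bm Y}^H\bm e_k\bm e_k^T\check{\bm Y}$, $\underline{\bm M}_k=(1+\underline\nu_k)^2\bm M_{\hat\epsilon(k)}-\bm M_{\check\epsilon(k)}$, $\overline{\bm M}_k=\bm M_{\check\epsilon(k)}-(1+\overline\nu_k)^2\bm M_{\hat\epsilon(k)}$, and, with $\hat{\bm M}_k=\bm e_{\hat\epsilon(k)}\bm e_{\check\epsilon(k)}^T\in\mathbb C^{N_V\times N_V}$, $\bm A_k=-\hat{\bm M}_k-\hat{\bm M}_k^H$, $\underline{\bm A}_k=(\tan\underline\delta_k+\mathbf i)\hat{\bm M}_k+(\tan\underline\delta_k-\mathbf i)\hat{\bm M}_k^H$, $\overline{\bm A}_k=-(\tan\overline\delta_k+\mathbf i)\hat{\bm M}_k-(\tan\overline\delta_k-\mathbf i)\hat{\bm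 M}_k^H$. Bounds: $0\le\underline V_n<\overline V_n$; $\overline P_n,\overline Q_n\in\mathbb R$; $\hat I_k^{\max},\check I_k^{\max}>0$; $-1\le\underline\nu_k<\overline\nu_k$; $\underline\delta_k<\overline\delta_k$ with $-\pi/2<\underline\delta_k\le-\arg(\rho_k)\le\overline\delta_k<\pi/2$; $\underline{\bm p},\overline{\bm p}\in\mathbb R_+^{N_D}$. Objective: costs $\gamma_n\ge0$ ($n\in\mathcal V$), weights $w\ge0$ and $\tilde\gamma>0$; $\bm C_0=w\sum_{n}\gamma_n\bm P_n+\tilde\gamma\big(\sum_{k\in\mathcal E}\tilde{\bm P}_k+\sum_{n\in\mathcal V}\operatorname{Re}(\tilde y_n)\bm M_n\big)$ with $\tilde{\bm P}_k=(\tilde{\bm S}_k+\tilde{\bm S}_k^H)/2$, $\tilde{\bm S}_k=\hat{\bm Y}^H\bm e_k\bm e_{\hat\epsilon(k)}^T+\check{\bm Y}^H\bm e_k\bm e_{\check\epsilon(k)}^T$; $\bm c_0=w\sum_n\gamma_n\bm h_n+\tilde\gamma\sum_{l\in\mathcal D}\eta_l\bm e_l$. Constraints: the $M=4N_V+7N_E+2N_D$ constraints $\bm v^H\bm C_m\bm v+\bm c_m^T\bm p\le b_m$ (which define $\bm C_m,\bm c_m,b_m$ for $m=1,\dots,M$) are, for all $n\in\mathcal V$, $k\in\mathcal E$: (1) $\bm v^H\bm M_n\bm v\le\overline V_n^2$; (2) $\bm v^H(-\bm M_n)\bm v\le-\underline V_n^2$; (3) $\bm v^H\bm P_n\bm v+\bm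 h_n^T\bm p\le\overline P_n$; (4) $\bm v^H\bm Q_n\bm v\le\overline Q_n$; (5) $\bm v^H\hat{\bm I}_k\bm v\le(\hat I_k^{\max})^2$; (6) $\bm v^H\check{\bm I}_k\bm v\le(\check I_k^{\max})^2$; (7) $\bm v^H\underline{\bm M}_k\bm v\le0$; (8) $\bm v^H\overline{\bm M}_k\bm v\le0$; (9) $\bm v^H\bm A_k\bm v\le0$; (10) $\bm v^H\underline{\bm A}_k\bm v\le0$; (11) $\bm v^H\overline{\bm A}_k\bm v\le0$; and componentwise (12) $\bm p\le\overline{\bm p}$; (13) $-\bm p\le-\underline{\bm p}$. *)

theory Defs
  imports "Jordan_Normal_Form.DL_Rank" "Jordan_Normal_Form.Schur_Decomposition"
begin

section \<open>Linear algebra\<close>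

definition outer :: "'a :: semiring_1 vec \<Rightarrow> 'a vec \<Rightarrow> 'a mat" where
  "outer u v = mat (dim_vec u) (dim_vec v) (\<lambda>(i, j). u $ i * v $ j)"

definition sum_mats :: "nat \<Rightarrow> nat \<Rightarrow> ('i \<Rightarrow> 'a :: comm_monoid_add mat) \<Rightarrow> 'i set \<Rightarrow> 'a mat" where
  "sum_mats nr nc F I = mat nr nc (\<lambda>ij. \<Sum>k\<in>I. F k $$ ij)"

definition sum_vecs :: "nat \<Rightarrow> ('i \<Rightarrow> 'a :: comm_monoid_add vec) \<Rightarrow> 'i set \<Rightarrow> 'a vec" where
  "sum_vecs n F I = vec n (\<lambda>i. \<Sum>k\<in>I. F k $ i)"

definition mat_trace :: "'a :: comm_monoid_add mat \<Rightarrow> 'a" where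
  "mat_trace A = (\<Sum>i<dim_row A. A $$ (i, i))"

text \<open>The form \<open>v\<^sup>H C v\<close>; recall that \<open>x \<bullet>c v\<close> conjugates its second argument.\<close>

definition quad_form :: "complex mat \<Rightarrow> complex vec \<Rightarrow> complex" where
  "quad_form C v = (C *\<^sub>v v) \<bullet>c v"

definition hermitian_mat :: "complex mat \<Rightarrow> bool" where
  "hermitian_mat A \<longleftrightarrow> mat_adjoint A = A"

definition psd_mat :: "complex mat \<Rightarrow> bool" where
  "psd_mat A \<longleftrightarrow> hermitian_mat A \<and> (\<forall>v \<in> carrier_vec (dim_row A). 0 \<le> Re (quad_form A v))"


section \<open>Grid and parameters\<close>

text \<open>Buses, AC branches and DC branches are numbered from 0, i.e. they are the elements of
  \<open>{..<NV}\<close>, \<open>{..<NE}\<close> and \<open>{..<ND}\<close>; the values of the functions outside these ranges are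
  irrelevant. The suffixes \<open>_src\<close> and \<open>_dst\<close> stand for the hat and the check accent (source and
  destination quantities), \<open>_lo\<close> and \<open>_up\<close> for lower and upper bounds.\<close>

record grid =
  NV :: nat
  NE :: nat
  ND :: nat
  ac_src :: "nat \<Rightarrow> nat"
  ac_dst :: "nat \<Rightarrow> nat"
  dc_src :: "nat \<Rightarrow> nat"
  dc_dst :: "nat \<Rightarrow> nat"
  y_series :: "nat \<Rightarrow> complex"
  y_src :: "nat \<Rightarrow> complex"
  y_dst :: "nat \<Rightarrow> complex"
  rho_src :: "nat \<Rightarrow> complex"
  rho_dst :: "nat \<Rightarrow> complex"
  y_bus :: "nat \<Rightarrow> complex"
  loss :: "nat \<Rightarrow> real"
  V_lo :: "nat \<Rightarrow> real"
  V_up :: "nat \<Rightarrow> real"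
  P_up :: "nat \<Rightarrow> real"
  Q_up :: "nat \<Rightarrow> real"
  I_src_max :: "nat \<Rightarrow> real"
  I_dst_max :: "nat \<Rightarrow> real"
  nu_lo :: "nat \<Rightarrow> real"
  nu_up :: "nat \<Rightarrow> real"
  delta_lo :: "nat \<Rightarrow> real"
  delta_up :: "nat \<Rightarrow> real"
  p_lo :: "nat \<Rightarrow> real"
  p_up :: "nat \<Rightarrow> real"
  gen_cost :: "nat \<Rightarrow> real"
  cost_weight :: real
  loss_weight :: real

definition rho :: "grid \<Rightarrow> nat \<Rightarrow> complex" where
  "rho G k = cnj (rho_src G k) * rho_dst G k"

definition ac_edges :: "grid \<Rightarrow> (nat \<times> nat) set" where
  "ac_edges G = (\<Union>k<NE G. {(ac_src G k, ac_dst G k), (ac_dst G k, ac_src G k)})"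

text \<open>Trees, for a simple undirected graph given by a symmetric edge relation. (The notion of
  tree in the AFP entry \<open>Graph_Theory\<close> only excludes directed cycles; on a symmetric relation it
  would count every edge as a cycle.)\<close>

definition connected_graph :: "'a set \<Rightarrow> ('a \<times> 'a) set \<Rightarrow> bool" where
  "connected_graph W E \<longleftrightarrow> W \<noteq> {} \<and> (\<forall>u\<in>W. \<forall>v\<in>W. (u, v) \<in> E\<^sup>*)"

definition graph_cycle :: "('a \<times> 'a) set \<Rightarrow> 'a list \<Rightarrow> bool" where
  "graph_cycle E cs \<longleftrightarrow> 3 \<le> length cs \<and> distinct cs \<and>
     (\<forall>i. Suc i < length cs \<longrightarrow> (cs ! i, cs ! Suc i) \<in> E) \<and> (last cs, hd cs) \<in> E"

definition tree_graph :: "'a set \<Rightarrow> ('a \<times> 'a) set \<Rightarrow> bool" where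
  "tree_graph W E \<longleftrightarrow> connected_graph W E \<and> (\<nexists>cs. graph_cycle E cs)"

definition valid_topology :: "grid \<Rightarrow> bool" where
  "valid_topology G \<longleftrightarrow>
     (\<forall>k<NE G. ac_src G k < NV G \<and> ac_dst G k < NV G \<and> ac_src G k \<noteq> ac_dst G k) \<and>
     (\<forall>l<ND G. dc_src G l < NV G \<and> dc_dst G l < NV G \<and> dc_src G l \<noteq> dc_dst G l) \<and>
     (\<nexists>k1 k2. k1 < NE G \<and> k2 < NE G \<and> k1 \<noteq> k2 \<and>
        ((ac_src G k1, ac_dst G k1) = (ac_src G k2, ac_dst G k2) \<or>
         (ac_src G k1, ac_dst G k1) = (ac_dst G k2, ac_src G k2))) \<and>
     tree_graph {..<NV G} (ac_edges G)"

definition valid_branches :: "grid \<Rightarrow> bool" where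
  "valid_branches G \<longleftrightarrow>
     (\<forall>k<NE G. rho_src G k \<noteq> 0 \<and> rho_dst G k \<noteq> 0 \<and>
        Re (y_series G k) > 0 \<and> Re (y_src G k) \<ge> 0 \<and> Re (y_dst G k) \<ge> 0 \<and>
        Im (y_series G k) \<le> 0 \<and>
        cmod (y_src G k) \<le> cmod (y_series G k) \<and> cmod (y_dst G k) \<le> cmod (y_series G k) \<and>
        \<bar>Arg (rho G k)\<bar> \<le> pi / 2) \<and>
     (\<forall>l<ND G. 0 \<le> loss G l \<and> loss G l < 1)"

definition valid_bounds :: "grid \<Rightarrow> bool" where
  "valid_bounds G \<longleftrightarrow>
     (\<forall>n<NV G. 0 \<le> V_lo G n \<and> V_lo G n < V_up G n) \<and>
     (\<forall>k<NE G. I_src_max G k > 0 \<and> I_dst_max G k > 0 \<and>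
        -1 \<le> nu_lo G k \<and> nu_lo G k < nu_up G k \<and>
        delta_lo G k < delta_up G k \<and>
        - pi / 2 < delta_lo G k \<and> delta_lo G k \<le> - Arg (rho G k) \<and>
        - Arg (rho G k) \<le> delta_up G k \<and> delta_up G k < pi / 2) \<and>
     (\<forall>l<ND G. 0 \<le> p_lo G l \<and> 0 \<le> p_up G l)"

definition valid_costs :: "grid \<Rightarrow> bool" where
  "valid_costs G \<longleftrightarrow>
     (\<forall>n<NV G. 0 \<le> gen_cost G n) \<and> 0 \<le> cost_weight G \<and> 0 < loss_weight G"

definition valid_grid :: "grid \<Rightarrow> bool" where
  "valid_grid G \<longleftrightarrow> valid_topology G \<and> valid_branches G \<and> valid_bounds G \<and> valid_costs G"


section \<open>Admittance matrices\<close>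

definition alpha_src :: "grid \<Rightarrow> nat \<Rightarrow> complex" where
  "alpha_src G k = (cmod (rho_src G k))\<^sup>2 * (y_series G k + y_src G k)"

definition beta_src :: "grid \<Rightarrow> nat \<Rightarrow> complex" where
  "beta_src G k = - rho G k * y_series G k"

definition alpha_dst :: "grid \<Rightarrow> nat \<Rightarrow> complex" where
  "alpha_dst G k = (cmod (rho_dst G k))\<^sup>2 * (y_series G k + y_dst G k)"

definition beta_dst :: "grid \<Rightarrow> nat \<Rightarrow> complex" where
  "beta_dst G k = - cnj (rho G k) * y_series G k"

abbreviation bus_vec :: "grid \<Rightarrow> nat \<Rightarrow> complex vec" where
  "bus_vec G \<equiv> unit_vec (NV G)"

abbreviation ac_vec :: "grid \<Rightarrow> nat \<Rightarrow> complex vec" where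
  "ac_vec G \<equiv> unit_vec (NE G)"

abbreviation dc_vec :: "grid \<Rightarrow> nat \<Rightarrow> real vec" where
  "dc_vec G \<equiv> unit_vec (ND G)"

definition Y_src :: "grid \<Rightarrow> complex mat" where
  "Y_src G = sum_mats (NE G) (NV G)
     (\<lambda>k. outer (ac_vec G k)
        (alpha_src G k \<cdot>\<^sub>v bus_vec G (ac_src G k) + beta_src G k \<cdot>\<^sub>v bus_vec G (ac_dst G k)))
     {..<NE G}"

definition Y_dst :: "grid \<Rightarrow> complex mat" where
  "Y_dst G = sum_mats (NE G) (NV G)
     (\<lambda>k. outer (ac_vec G k)
        (alpha_dst G k \<cdot>\<^sub>v bus_vec G (ac_dst G k) + beta_dst G k \<cdot>\<^sub>v bus_vec G (ac_src G k)))
     {..<NE G}"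

definition alpha_bus :: "grid \<Rightarrow> nat \<Rightarrow> complex" where
  "alpha_bus G n = y_bus G n + (\<Sum>k | k < NE G \<and> ac_src G k = n. alpha_src G k)
     + (\<Sum>k | k < NE G \<and> ac_dst G k = n. alpha_dst G k)"

definition Y_mat :: "grid \<Rightarrow> complex mat" where
  "Y_mat G = sum_mats (NV G) (NV G)
     (\<lambda>n. outer (bus_vec G n)
        (alpha_bus G n \<cdot>\<^sub>v bus_vec G n
         + sum_vecs (NV G) (\<lambda>k. beta_src G k \<cdot>\<^sub>v bus_vec G (ac_dst G k)) {k. k < NE G \<and> ac_src G k = n}
         + sum_vecs (NV G) (\<lambda>k. beta_dst G k \<cdot>\<^sub>v bus_vec G (ac_src G k)) {k. k < NE G \<and> ac_dst G k = n}))
     {..<NV G}"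


section \<open>Constraint and objective matrices\<close>

definition S_mat :: "grid \<Rightarrow> nat \<Rightarrow> complex mat" where
  "S_mat G n = mat_adjoint (Y_mat G) * outer (bus_vec G n) (bus_vec G n)"

definition P_mat :: "grid \<Rightarrow> nat \<Rightarrow> complex mat" where
  "P_mat G n = (1 / 2) \<cdot>\<^sub>m (S_mat G n + mat_adjoint (S_mat G n))"

definition Q_mat :: "grid \<Rightarrow> nat \<Rightarrow> complex mat" where
  "Q_mat G n = (1 / (2 * \<i>)) \<cdot>\<^sub>m (S_mat G n - mat_adjoint (S_mat G n))"

definition M_mat :: "grid \<Rightarrow> nat \<Rightarrow> complex mat" where
  "M_mat G n = outer (bus_vec G n) (bus_vec G n)"

definition h_vec :: "grid \<Rightarrow> nat \<Rightarrow> real vec" where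
  "h_vec G n = sum_vecs (ND G) (dc_vec G) {l. l < ND G \<and> dc_src G l = n}
     - sum_vecs (ND G) (\<lambda>l. (1 - loss G l) \<cdot>\<^sub>v dc_vec G l) {l. l < ND G \<and> dc_dst G l = n}"

definition I_src_mat :: "grid \<Rightarrow> nat \<Rightarrow> complex mat" where
  "I_src_mat G k = mat_adjoint (Y_src G) * outer (ac_vec G k) (ac_vec G k) * Y_src G"

definition I_dst_mat :: "grid \<Rightarrow> nat \<Rightarrow> complex mat" where
  "I_dst_mat G k = mat_adjoint (Y_dst G) * outer (ac_vec G k) (ac_vec G k) * Y_dst G"

definition M_lo_mat :: "grid \<Rightarrow> nat \<Rightarrow> complex mat" where
  "M_lo_mat G k =
     complex_of_real ((1 + nu_lo G k)\<^sup>2) \<cdot>\<^sub>m M_mat G (ac_src G k) - M_mat G (ac_dst G k)"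

definition M_up_mat :: "grid \<Rightarrow> nat \<Rightarrow> complex mat" where
  "M_up_mat G k =
     M_mat G (ac_dst G k) - complex_of_real ((1 + nu_up G k)\<^sup>2) \<cdot>\<^sub>m M_mat G (ac_src G k)"

definition M_cross_mat :: "grid \<Rightarrow> nat \<Rightarrow> complex mat" where
  "M_cross_mat G k = outer (bus_vec G (ac_src G k)) (bus_vec G (ac_dst G k))"

definition A_mat :: "grid \<Rightarrow> nat \<Rightarrow> complex mat" where
  "A_mat G k = - M_cross_mat G k - mat_adjoint (M_cross_mat G k)"

definition A_lo_mat :: "grid \<Rightarrow> nat \<Rightarrow> complex mat" where
  "A_lo_mat G k = (tan (delta_lo G k) + \<i>) \<cdot>\<^sub>m M_cross_mat G k
     + (tan (delta_lo G k) - \<i>) \<cdot>\<^sub>m mat_adjoint (M_cross_mat G k)"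

definition A_up_mat :: "grid \<Rightarrow> nat \<Rightarrow> complex mat" where
  "A_up_mat G k = (- (tan (delta_up G k) + \<i>)) \<cdot>\<^sub>m M_cross_mat G k
     - (tan (delta_up G k) - \<i>) \<cdot>\<^sub>m mat_adjoint (M_cross_mat G k)"

definition S_branch_mat :: "grid \<Rightarrow> nat \<Rightarrow> complex mat" where
  "S_branch_mat G k = mat_adjoint (Y_src G) * outer (ac_vec G k) (bus_vec G (ac_src G k))
     + mat_adjoint (Y_dst G) * outer (ac_vec G k) (bus_vec G (ac_dst G k))"

definition P_branch_mat :: "grid \<Rightarrow> nat \<Rightarrow> complex mat" where
  "P_branch_mat G k = (1 / 2) \<cdot>\<^sub>m (S_branch_mat G k + mat_adjoint (S_branch_mat G k))"

definition C0_mat :: "grid \<Rightarrow> complex mat" where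
  "C0_mat G =
     complex_of_real (cost_weight G) \<cdot>\<^sub>m
       sum_mats (NV G) (NV G) (\<lambda>n. complex_of_real (gen_cost G n) \<cdot>\<^sub>m P_mat G n) {..<NV G}
     + complex_of_real (loss_weight G) \<cdot>\<^sub>m
       (sum_mats (NV G) (NV G) (P_branch_mat G) {..<NE G}
        + sum_mats (NV G) (NV G) (\<lambda>n. complex_of_real (Re (y_bus G n)) \<cdot>\<^sub>m M_mat G n) {..<NV G})"

definition c0_vec :: "grid \<Rightarrow> real vec" where
  "c0_vec G = cost_weight G \<cdot>\<^sub>v sum_vecs (ND G) (\<lambda>n. gen_cost G n \<cdot>\<^sub>v h_vec G n) {..<NV G}
     + loss_weight G \<cdot>\<^sub>v sum_vecs (ND G) (\<lambda>l. loss G l \<cdot>\<^sub>v dc_vec G l) {..<ND G}"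


section \<open>The optimization problems\<close>

text \<open>A triple \<open>(C, c, b)\<close> encodes the constraint \<open>v\<^sup>H C v + c\<^sup>T p \<le> b\<close>. The first list consists of
  the constraints on bus voltages, bus powers and AC branches, the second one of the
  componentwise bounds on \<open>p\<close>.\<close>

type_synonym opf_constraint = "complex mat \<times> real vec \<times> real"

definition ac_constraints :: "grid \<Rightarrow> opf_constraint list" where
  "ac_constraints G =
     map (\<lambda>n. (M_mat G n, 0\<^sub>v (ND G), (V_up G n)\<^sup>2)) [0..<NV G] @
     map (\<lambda>n. (- M_mat G n, 0\<^sub>v (ND G), - (V_lo G n)\<^sup>2)) [0..<NV G] @
     map (\<lambda>n. (P_mat G n, h_vec G n, P_up G n)) [0..<NV G] @
     map (\<lambda>n. (Q_mat G n, 0\<^sub>v (ND G), Q_up G n)) [0..<NV G] @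
     map (\<lambda>k. (I_src_mat G k, 0\<^sub>v (ND G), (I_src_max G k)\<^sup>2)) [0..<NE G] @
     map (\<lambda>k. (I_dst_mat G k, 0\<^sub>v (ND G), (I_dst_max G k)\<^sup>2)) [0..<NE G] @
     map (\<lambda>k. (M_lo_mat G k, 0\<^sub>v (ND G), 0)) [0..<NE G] @
     map (\<lambda>k. (M_up_mat G k, 0\<^sub>v (ND G), 0)) [0..<NE G] @
     map (\<lambda>k. (A_mat G k, 0\<^sub>v (ND G), 0)) [0..<NE G] @
     map (\<lambda>k. (A_lo_mat G k, 0\<^sub>v (ND G), 0)) [0..<NE G] @
     map (\<lambda>k. (A_up_mat G k, 0\<^sub>v (ND G), 0)) [0..<NE G]"

definition dc_constraints :: "grid \<Rightarrow> opf_constraint list" where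
  "dc_constraints G =
     map (\<lambda>l. (0\<^sub>m (NV G) (NV G), dc_vec G l, p_up G l)) [0..<ND G] @
     map (\<lambda>l. (0\<^sub>m (NV G) (NV G), - dc_vec G l, - p_lo G l)) [0..<ND G]"

definition opf_constraints :: "grid \<Rightarrow> opf_constraint list" where
  "opf_constraints G = ac_constraints G @ dc_constraints G"

lemma length_opf_constraints: "length (opf_constraints G) = 4 * NV G + 7 * NE G + 2 * ND G"
  by (simp add: opf_constraints_def ac_constraints_def dc_constraints_def)

text \<open>All coefficient matrices are Hermitian (\<open>opf_constraints_hermitian\<close>, \<open>C0_hermitian\<close>), so that quadratic forms, and traces of
  products with a Hermitian matrix, are real; \<open>Re\<close> only changes the type.\<close>

definition opf_lhs :: "complex mat \<Rightarrow> real vec \<Rightarrow> complex vec \<Rightarrow> real vec \<Rightarrow> real" where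
  "opf_lhs C c v p = Re (quad_form C v) + c \<bullet> p"

definition sdr_lhs :: "complex mat \<Rightarrow> real vec \<Rightarrow> complex mat \<Rightarrow> real vec \<Rightarrow> real" where
  "sdr_lhs C c V p = Re (mat_trace (C * V)) + c \<bullet> p"

definition opf_strictly_feasible :: "grid \<Rightarrow> bool" where
  "opf_strictly_feasible G \<longleftrightarrow>
     (\<exists>v p. v \<in> carrier_vec (NV G) \<and> p \<in> carrier_vec (ND G) \<and> (\<forall>l<ND G. 0 \<le> p $ l) \<and>
        (\<forall>(C, c, b) \<in> set (ac_constraints G). opf_lhs C c v p < b) \<and>
        (\<forall>(C, c, b) \<in> set (dc_constraints G). opf_lhs C c v p \<le> b))"

definition sdr_feasible :: "grid \<Rightarrow> complex mat \<Rightarrow> real vec \<Rightarrow> bool" where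
  "sdr_feasible G V p \<longleftrightarrow>
     V \<in> carrier_mat (NV G) (NV G) \<and> hermitian_mat V \<and> p \<in> carrier_vec (ND G) \<and>
     (\<forall>(C, c, b) \<in> set (opf_constraints G). sdr_lhs C c V p \<le> b) \<and>
     psd_mat V"

definition sdr_optimizer :: "grid \<Rightarrow> complex mat \<Rightarrow> real vec \<Rightarrow> bool" where
  "sdr_optimizer G V p \<longleftrightarrow> sdr_feasible G V p \<and>
     (\<forall>W q. sdr_feasible G W q \<longrightarrow>
        sdr_lhs (C0_mat G) (c0_vec G) V p \<le> sdr_lhs (C0_mat G) (c0_vec G) W q)"

definition sdr_exact :: "grid \<Rightarrow> bool" where
  "sdr_exact G \<longleftrightarrow> (\<forall>V p. sdr_optimizer G V p \<longrightarrow> vec_space.rank (NV G) V = 1)"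


section \<open>The coefficient matrices are Hermitian\<close>

lemma dim_mat_adjoint: "dim_row (mat_adjoint A) = dim_col A" "dim_col (mat_adjoint A) = dim_row A"
  by (simp_all add: mat_adjoint_def)

lemma index_mat_adjoint:
  "i < dim_col A \<Longrightarrow> j < dim_row A \<Longrightarrow> mat_adjoint A $$ (i, j) = conjugate (A $$ (j, i))"
  by (simp add: mat_adjoint_def mat_of_rows_def)

definition herm :: "nat \<Rightarrow> complex mat \<Rightarrow> bool" where
  "herm n A \<longleftrightarrow> A \<in> carrier_mat n n \<and> hermitian_mat A"

lemma herm_iff:
  "herm n A \<longleftrightarrow> A \<in> carrier_mat n n \<and> (\<forall>i<n. \<forall>j<n. cnj (A $$ (j, i)) = A $$ (i, j))"
proof (cases "A \<in> carrier_mat n n")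
  case True
  then show ?thesis
    unfolding herm_def hermitian_mat_def mat_eq_iff
    by (auto simp: dim_mat_adjoint index_mat_adjoint)
qed (simp add: herm_def)

lemma hermI:
  assumes "A \<in> carrier_mat n n" "\<And>i j. i < n \<Longrightarrow> j < n \<Longrightarrow> cnj (A $$ (j, i)) = A $$ (i, j)"
  shows "herm n A"
  using assms unfolding herm_iff by blast

lemma hermD:
  assumes "herm n A"
  shows "A \<in> carrier_mat n n" "dim_row A = n" "dim_col A = n"
    "i < n \<Longrightarrow> j < n \<Longrightarrow> cnj (A $$ (j, i)) = A $$ (i, j)"
  using assms unfolding herm_iff by blast+

lemma herm_add: "herm n A \<Longrightarrow> herm n B \<Longrightarrow> herm n (A + B)"
  by (rule hermI) (simp_all add: hermD)

lemma herm_minus: "herm n A \<Longrightarrow> herm n B \<Longrightarrow> herm n (A - B)"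
  by (rule hermI) (simp_all add: hermD minus_carrier_mat)

lemma herm_uminus: "herm n A \<Longrightarrow> herm n (- A)"
  by (rule hermI) (simp_all add: hermD)

lemma herm_smult: "herm n A \<Longrightarrow> herm n (complex_of_real r \<cdot>\<^sub>m A)"
  by (rule hermI) (simp_all add: hermD)

lemma herm_zero: "herm n (0\<^sub>m n n)"
  by (rule hermI) simp_all

lemma herm_sum_mats:
  assumes "\<And>k. k \<in> I \<Longrightarrow> herm n (F k)"
  shows "herm n (sum_mats n n F I)"
  by (rule hermI) (simp_all add: sum_mats_def hermD(4)[OF assms])

lemma herm_M_mat: "herm (NV G) (M_mat G n)"
  by (rule hermI) (simp_all add: M_mat_def outer_def unit_vec_def)

lemma herm_P:
  assumes S: "S \<in> carrier_mat n n"
  shows "herm n ((1 / 2) \<cdot>\<^sub>m (S + mat_adjoint S))"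
proof -
  have d: "dim_row S = n" "dim_col S = n" using S by auto
  show ?thesis
    by (rule hermI) (simp_all add: d dim_mat_adjoint index_mat_adjoint carrier_matI)
qed

lemma herm_Q:
  assumes S: "S \<in> carrier_mat n n"
  shows "herm n ((1 / (2 * \<i>)) \<cdot>\<^sub>m (S - mat_adjoint S))"
proof -
  have d: "dim_row S = n" "dim_col S = n" using S by auto
  show ?thesis
    by (rule hermI) (simp_all add: d dim_mat_adjoint index_mat_adjoint carrier_matI right_diff_distrib)
qed

lemma mult_outer_unit:
  assumes "B \<in> carrier_mat m n" "k < m"
  shows "mat_adjoint B * outer (unit_vec m k) (unit_vec m k) * B
    = mat n n (\<lambda>(i, j). cnj (B $$ (k, i)) * B $$ (k, j))"
proof (rule eq_matI)
  fix i j assume "i < dim_row (mat n n (\<lambda>(i, j). cnj (B $$ (k, i)) * B $$ (k, j)))"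
    "j < dim_col (mat n n (\<lambda>(i, j). cnj (B $$ (k, i)) * B $$ (k, j)))"
  then have ij: "i < n" "j < n" by auto
  have 1: "(mat_adjoint B * outer (unit_vec m k) (unit_vec m k)) $$ (i, l)
      = (if l = k then cnj (B $$ (k, i)) else 0)" if "l < m" for l
    using assms ij that
    by (simp add: scalar_prod_def outer_def unit_vec_def dim_mat_adjoint index_mat_adjoint
        if_distrib[of "\<lambda>x. _ * x"] cong: if_cong)
  have "(mat_adjoint B * outer (unit_vec m k) (unit_vec m k) * B) $$ (i, j)
      = (\<Sum>l = 0..<m. (mat_adjoint B * outer (unit_vec m k) (unit_vec m k)) $$ (i, l) * B $$ (l, j))"
    using assms ij
    by (auto simp: times_mat_def[of "mat_adjoint B * _"] scalar_prod_def dim_mat_adjoint outer_def intro!: sum.cong)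
  also have "\<dots> = (\<Sum>l = 0..<m. if l = k then cnj (B $$ (k, i)) * B $$ (l, j) else 0)"
    by (rule sum.cong) (simp_all add: 1)
  also have "\<dots> = cnj (B $$ (k, i)) * B $$ (k, j)"
    using assms by simp
  finally show "(mat_adjoint B * outer (unit_vec m k) (unit_vec m k) * B) $$ (i, j)
      = mat n n (\<lambda>(i, j). cnj (B $$ (k, i)) * B $$ (k, j)) $$ (i, j)"
    using ij by simp
qed (use assms in \<open>simp_all add: dim_mat_adjoint\<close>)

lemma herm_gram:
  assumes "B \<in> carrier_mat m n" "k < m"
  shows "herm n (mat_adjoint B * outer (unit_vec m k) (unit_vec m k) * B)"
  unfolding mult_outer_unit[OF assms] by (rule hermI) simp_all

lemma carrier_Y: "Y_src G \<in> carrier_mat (NE G) (NV G)" "Y_dst G \<in> carrier_mat (NE G) (NV G)"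
    "Y_mat G \<in> carrier_mat (NV G) (NV G)"
  by (simp_all add: Y_src_def Y_dst_def Y_mat_def sum_mats_def)

lemma carrier_S: "S_mat G n \<in> carrier_mat (NV G) (NV G)"
    "S_branch_mat G k \<in> carrier_mat (NV G) (NV G)" "M_cross_mat G k \<in> carrier_mat (NV G) (NV G)"
  by (rule carrier_matI;
      simp add: S_mat_def S_branch_mat_def M_cross_mat_def outer_def dim_mat_adjoint
        carrier_matD[OF carrier_Y(1)] carrier_matD[OF carrier_Y(2)] carrier_matD[OF carrier_Y(3)])+

lemma herm_A: "herm (NV G) (A_mat G k)"
    "herm (NV G) (A_lo_mat G k)" "herm (NV G) (A_up_mat G k)"
proof -
  have d: "dim_row (M_cross_mat G k) = NV G" "dim_col (M_cross_mat G k) = NV G"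
    using carrier_S(3)[of G k] by auto
  show "herm (NV G) (A_mat G k)" "herm (NV G) (A_lo_mat G k)" "herm (NV G) (A_up_mat G k)"
    unfolding A_mat_def A_lo_mat_def A_up_mat_def
    by (rule hermI; simp add: d dim_mat_adjoint index_mat_adjoint carrier_matI algebra_simps)+
qed

lemma opf_constraints_hermitian:
  assumes "(C, c, b) \<in> set (opf_constraints G)"
  shows "C \<in> carrier_mat (NV G) (NV G) \<and> hermitian_mat C"
proof -
  have P: "herm (NV G) (P_mat G n)" and Q: "herm (NV G) (Q_mat G n)" for n
    unfolding P_mat_def Q_mat_def by (intro herm_P herm_Q carrier_S)+
  have I: "herm (NV G) (I_src_mat G k)" "herm (NV G) (I_dst_mat G k)" if "k < NE G" for k
    unfolding I_src_mat_def I_dst_mat_def by (intro herm_gram carrier_Y that)+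
  have M: "herm (NV G) (M_lo_mat G k)" "herm (NV G) (M_up_mat G k)" for k
    unfolding M_lo_mat_def M_up_mat_def by (intro herm_minus herm_smult herm_M_mat)+
  show ?thesis
    unfolding herm_def[symmetric]
    using assms unfolding opf_constraints_def ac_constraints_def dc_constraints_def
    by (auto intro: P Q I M herm_M_mat herm_A herm_zero herm_uminus)
qed

lemma C0_hermitian: "C0_mat G \<in> carrier_mat (NV G) (NV G) \<and> hermitian_mat (C0_mat G)"
  unfolding herm_def[symmetric] C0_mat_def P_branch_mat_def[abs_def] P_mat_def
  by (intro herm_add herm_smult herm_sum_mats herm_P herm_M_mat carrier_S)

end

(* Moving the entry of V that belongs to branch k in the direction rho_k weakly decreases every
   constraint function and strictly decreases the objective. Given a feasible V, move each such
   entry until |V_sd|^2 = V_ss V_dd; since the network is a tree, the new edge entries and the old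
   diagonal are those of a rank-one matrix v v^H, which is again feasible. Hence an optimizer
   already satisfies |V_sd|^2 = V_ss V_dd on all branches. Comparing with convex combinations with
   a strictly feasible point shows that its diagonal cannot vanish at only one end of a branch, so
   by connectedness it is positive. Then adjacent columns of V are proportional. *)

theory Submission
  imports Defs
begin

section \<open>Potentials on trees\<close>

text \<open>The direction \<open>rho G k\<close> suits all constraints at once.
  \<open>- Arg (rho G k)\<close> lies in the angle window. In the power terms
  \<open>beta_src\<close> and \<open>beta_dst\<close> turn the shift into a multiple of
  \<open>cnj (y_series G k)\<close>, whose real and imaginary parts are nonnegative by the sign
  assumptions; in the current terms the shunt admittance is dominated by the series one. Voltage
  constraints see only the diagonal, which never moves. All coefficient matrices live on the
  diagonal and the branch entries, so the other entries of V may be replaced freely. The obstacle is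
  a zero on the diagonal, which \<open>V_lo\<close> = 0 permits: for a tight minor at an edge (a, b)
  the relation V_aa * col b = V_ab * col a then degenerates to 0 = 0 and says nothing about column
  b. Optimality makes the minors of V itself tight but does not identify V with v v^H. The passage
  to rank one instead uses that a tight 2x2 minor of a positive semidefinite matrix yields a null
  vector supported on the two ends.\<close>

lemma rtrancl_distinct_path:
  assumes "(x, y) \<in> R\<^sup>*"
  obtains ps where "ps \<noteq> []" "hd ps = x" "last ps = y" "distinct ps"
    "\<And>i. Suc i < length ps \<Longrightarrow> (ps ! i, ps ! Suc i) \<in> R"
proof -
  have "\<exists>ps. ps \<noteq> [] \<and> hd ps = x \<and> last ps = y \<and> distinct ps \<and>
      (\<forall>i. Suc i < length ps \<longrightarrow> (ps ! i, ps ! Suc i) \<in> R)"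
    using assms
  proof (induction rule: converse_rtrancl_induct)
    case base
    show ?case by (rule exI[of _ "[y]"]) simp
  next
    case (step x z)
    then obtain ps where ps: "ps \<noteq> []" "hd ps = z" "last ps = y" "distinct ps"
      "\<And>i. Suc i < length ps \<Longrightarrow> (ps ! i, ps ! Suc i) \<in> R" by blast
    show ?case
    proof (cases "x \<in> set ps")
      case True
      then obtain j where j: "j < length ps" "ps ! j = x" by (auto simp: in_set_conv_nth)
      \<comment> \<open>If \<open>x\<close> already lies on the path, everything before its
        occurrence is a loop and is cut off.\<close>
      show ?thesis
        by (rule exI[of _ "drop j ps"]) (use j ps in \<open>auto simp: hd_drop_conv_nth\<close>)
    next
      case False
      have "(x # ps) ! Suc i = ps ! i" for i by simp
      moreover have "((x # ps) ! i, (x # ps) ! Suc i) \<in> R" if "Suc i < length (x # ps)" for i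
        using that ps step(1) by (cases i) (auto simp: hd_conv_nth)
      ultimately show ?thesis
        by (intro exI[of _ "x # ps"]) (use False ps in auto)
    qed
  qed
  then show thesis using that by blast
qed

lemma rtrancl_crossing_edge:
  assumes "(x, y) \<in> R\<^sup>*" "x \<in> S" "y \<notin> S"
  obtains a b where "(a, b) \<in> R" "a \<in> S" "b \<notin> S"
proof -
  have "y \<notin> S \<longrightarrow> (\<exists>a b. (a, b) \<in> R \<and> a \<in> S \<and> b \<notin> S)"
    using assms(1) by (induction) (use assms(2) in blast)+
  then show thesis using assms(3) that by blast
qed

text \<open>A second edge from \<open>b\<close> into the connected set \<open>S\<close> would close a cycle through \<open>b\<close>.\<close>

lemma acyclic_unique_neighbour:
  assumes acyclic: "\<nexists>cs. graph_cycle E cs" and sym: "sym E"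
    and conn: "\<forall>u\<in>S. \<forall>v\<in>S. (u, v) \<in> (E \<inter> S \<times> S)\<^sup>*"
    and a: "a \<in> S" "(a, b) \<in> E" and c: "c \<in> S" "(c, b) \<in> E" and b: "b \<notin> S"
  shows "c = a"
proof (rule ccontr)
  assume ne: "c \<noteq> a"
  have "(a, c) \<in> (E \<inter> S \<times> S)\<^sup>*" using conn a c by blast
  then obtain ps where ps: "ps \<noteq> []" "hd ps = a" "last ps = c" "distinct ps"
    "\<And>i. Suc i < length ps \<Longrightarrow> (ps ! i, ps ! Suc i) \<in> E \<inter> S \<times> S"
    by (rule rtrancl_distinct_path) blast
  have in_S: "ps ! i \<in> S" if "i < length ps" for i
  proof (cases i)
    case 0
    then show ?thesis using ps a by (simp add: hd_conv_nth)
  next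
    case (Suc j)
    then show ?thesis using ps(5)[of j] that by simp
  qed
  then have "b \<notin> set ps" using b by (auto simp: in_set_conv_nth)
  \<comment> \<open>Two vertices on the path and \<open>b\<close> make the three that
    \<open>graph_cycle\<close> demands.\<close>
  moreover have "2 \<le> length ps"
  proof (rule ccontr)
    assume "\<not> 2 \<le> length ps"
    with ps(1) obtain x where "ps = [x]" by (cases ps) (auto simp: Suc_le_eq)
    then show False using ps ne by simp
  qed
  moreover have "(b, a) \<in> E" using a sym by (blast dest: symD)
  then have "((b # ps) ! i, (b # ps) ! Suc i) \<in> E" if "Suc i < length (b # ps)" for i
    using that ps by (cases i) (auto simp: hd_conv_nth)
  ultimately have "graph_cycle E (b # ps)"
    using ps c by (auto simp: graph_cycle_def)
  then show False using acyclic by blast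
qed

text \<open>Without cycles there is no compatibility condition on \<open>u\<close>. A potential on a
  connected set extends to any vertex \<open>b\<close> adjacent to it, because \<open>b\<close> has
  a single neighbour there and so a single equation to satisfy; hence a largest such set is all of
  \<open>W\<close>.\<close>

lemma tree_potential:
  fixes u :: "'a \<Rightarrow> 'a \<Rightarrow> complex"
  assumes fin: "finite W" and tree: "tree_graph W E" and E: "E \<subseteq> W \<times> W" "irrefl E"
    and u1: "\<And>x y. (x, y) \<in> E \<Longrightarrow> cmod (u x y) = 1"
    and u2: "\<And>x y. (x, y) \<in> E \<Longrightarrow> (y, x) \<in> E \<and> u y x = cnj (u x y)"
  obtains \<phi> where "\<And>x. cmod (\<phi> x) = 1" "\<And>x y. (x, y) \<in> E \<Longrightarrow> \<phi> x * cnj (\<phi> y) = u x y"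
proof -
  have conn: "W \<noteq> {}" "\<forall>x\<in>W. \<forall>y\<in>W. (x, y) \<in> E\<^sup>*" and acyc: "\<nexists>cs. graph_cycle E cs"
    using tree by (auto simp: tree_graph_def connected_graph_def)
  have sym: "sym E" using u2 by (auto simp: sym_def)
  \<comment> \<open>Connectedness is demanded inside \<open>S\<close>, not merely in the graph: the
    cycle through an outside vertex has to return within \<open>S\<close>.\<close>
  define good where "good S \<phi> \<longleftrightarrow> S \<noteq> {} \<and> S \<subseteq> W \<and> (\<forall>x\<in>S. \<forall>y\<in>S. (x, y) \<in> (E \<inter> S \<times> S)\<^sup>*) \<and>
    (\<forall>x. cmod (\<phi> x) = 1) \<and> (\<forall>x\<in>S. \<forall>y\<in>S. (x, y) \<in> E \<longrightarrow> \<phi> x * cnj (\<phi> y) = u x y)" for S \<phi>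
  obtain w where w: "w \<in> W" using conn by blast
  have "good {w} (\<lambda>_. 1)" using w E(2) by (simp add: good_def irrefl_def)
  then have "\<exists>S. (\<exists>\<phi>. good S \<phi>) \<and> (\<forall>T. (\<exists>\<phi>. good T \<phi>) \<longrightarrow> card T \<le> card S)"
    by (intro ex_has_greatest_nat[of _ "{w}" card "Suc (card W)"] exI[of _ "\<lambda>_. 1"])
      (auto simp: good_def less_Suc_eq_le intro!: card_mono[OF fin])
  then obtain S \<phi> where g: "good S \<phi>" and max: "\<And>T \<psi>. good T \<psi> \<Longrightarrow> card T \<le> card S" by blast
  have "W \<subseteq> S"
  proof (rule ccontr)
    assume "\<not> W \<subseteq> S"
    then obtain x y where "x \<in> S" "y \<in> W" "y \<notin> S" using g by (auto simp: good_def)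
    moreover have "(x, y) \<in> E\<^sup>*" using calculation g conn by (auto simp: good_def)
    ultimately obtain a b where ab: "(a, b) \<in> E" "a \<in> S" "b \<notin> S"
      using rtrancl_crossing_edge[of x y E S] by metis
    have ba: "(b, a) \<in> E" "u b a = cnj (u a b)" using u2 ab by blast+
    have only: "c = a" if "c \<in> S" "(c, b) \<in> E" for c
      using g acyclic_unique_neighbour[OF acyc sym _ ab(2,1) that ab(3)] by (auto simp: good_def)
    have only': "c = a" if "c \<in> S" "(b, c) \<in> E" for c
      using only[of c] that sym by (auto simp: sym_def)
    define T where "T = insert b S"
    \<comment> \<open>The value at \<open>b\<close> is forced by the edge to \<open>a\<close>, since
      \<phi> a * cnj (\<phi> a) = 1.\<close>
    define \<psi> where "\<psi> = \<phi>(b := u b a * \<phi> a)"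
    have n\<phi>: "\<phi> x * cnj (\<phi> x) = 1" for x
      using g by (simp add: good_def complex_norm_square[symmetric])
    have sub: "(E \<inter> S \<times> S)\<^sup>* \<subseteq> (E \<inter> T \<times> T)\<^sup>*" by (rule rtrancl_mono) (auto simp: T_def)
    have e: "(a, b) \<in> (E \<inter> T \<times> T)\<^sup>*" "(b, a) \<in> (E \<inter> T \<times> T)\<^sup>*" using ab ba by (auto simp: T_def)
    have S: "(x, y) \<in> (E \<inter> T \<times> T)\<^sup>*" if "x \<in> S" "y \<in> S" for x y
      using g sub that by (auto simp: good_def)
    have "good T \<psi>"
      unfolding good_def
    proof (intro conjI ballI allI impI)
      show "T \<noteq> {}" "T \<subseteq> W" using g ab E by (auto simp: T_def good_def)
      show "(x, y) \<in> (E \<inter> T \<times> T)\<^sup>*" if "x \<in> T" "y \<in> T" for x y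
        using that e S[of x y] S[OF _ ab(2), of x] S[OF ab(2), of y]
        by (auto simp: T_def intro: rtrancl_trans)
      show "cmod (\<psi> x) = 1" for x
        using g u1[OF ba(1)] by (auto simp: \<psi>_def good_def norm_mult)
      show "\<psi> x * cnj (\<psi> y) = u x y" if xy: "x \<in> T" "y \<in> T" "(x, y) \<in> E" for x y
      proof (cases "x = b \<or> y = b")
        case False
        then show ?thesis using xy g by (auto simp: T_def \<psi>_def good_def)
      next
        case True
        have "x \<noteq> y" using xy E(2) by (auto simp: irrefl_def)
        with True xy consider "x = b" "y \<in> S" | "y = b" "x \<in> S" by (auto simp: T_def)
        then show ?thesis
        proof cases
          case 1
          then have "y = a" using only' xy by blast
          then show ?thesis using 1 ab(2,3) n\<phi>[of a] by (auto simp: \<psi>_def mult.assoc)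
        next
          case 2
          then have "x = a" using only xy by blast
          then show ?thesis using 2 ab(2,3) n\<phi>[of a] ba
            by (auto simp: \<psi>_def mult.left_commute)
        qed
      qed
    qed
    then have "card T \<le> card S" by (rule max)
    moreover have "finite S" using g fin by (auto simp: good_def intro: finite_subset)
    ultimately show False using ab by (simp add: T_def)
  qed
  then have "E \<subseteq> S \<times> S" using E(1) by blast
  then have "\<phi> x * cnj (\<phi> y) = u x y" if "(x, y) \<in> E" for x y
    using g that by (auto simp: good_def)
  moreover have "cmod (\<phi> x) = 1" for x using g by (simp add: good_def)
  ultimately show thesis using that by blast
qed

section \<open>Moving a complex number along a ray up to a prescribed modulus\<close>

lemma ex_shift_norm_eq:
  fixes z d :: complex
  assumes "d \<noteq> 0" "cmod z \<le> R"
  obtains t where "0 \<le> t" "cmod (z + of_real t * d) = R"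
proof -
  \<comment> \<open>At this parameter the displacement has modulus \<open>R + cmod z\<close>, so the
    reverse triangle inequality gives modulus at least \<open>R\<close>, and the intermediate value
    theorem applies.\<close>
  let ?T = "(R + cmod z) / cmod d"
  have "R \<ge> 0" using assms(2) norm_ge_zero[of z] by linarith
  then have T: "0 \<le> ?T" by simp
  have "cmod (of_real ?T * d) = ?T * cmod d"
    unfolding norm_mult norm_of_real abs_of_nonneg[OF T] ..
  then have "R = cmod (of_real ?T * d) - cmod z" using assms(1) by simp
  also have "\<dots> \<le> cmod (z + of_real ?T * d)"
    using norm_diff_ineq[of "of_real ?T * d" z] by (simp add: add.commute)
  finally have "R \<le> cmod (z + of_real ?T * d)" .
  moreover have "continuous_on {0..?T} (\<lambda>t. cmod (z + of_real t * d))"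
    by (intro continuous_intros)
  ultimately obtain t where "0 \<le> t" "cmod (z + of_real t * d) = R"
    using IVT'[of "\<lambda>t. cmod (z + of_real t * d)" 0 R ?T] assms(2) T by fastforce
  then show thesis by (rule that)
qed

section \<open>Positive semidefinite matrices\<close>

lemma quad_form_sum:
  assumes "A \<in> carrier_mat n n" "v \<in> carrier_vec n"
  shows "quad_form A v = (\<Sum>i<n. (A *\<^sub>v v) $ i * cnj (v $ i))"
  using assms by (auto simp: quad_form_def scalar_prod_def atLeast0LessThan)

lemma mat_vec_sum:
  assumes "A \<in> carrier_mat n n" "v \<in> carrier_vec n" "i < n"
  shows "(A *\<^sub>v v) $ i = (\<Sum>j<n. A $$ (i, j) * v $ j)"
  using assms by (auto simp: scalar_prod_def atLeast0LessThan)

lemma mat_vec_two: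
  assumes "A \<in> carrier_mat n n" "i < n" "s < n" "d < n" "s \<noteq> d"
  shows "(A *\<^sub>v (vec n (\<lambda>j. if j = s then a else if j = d then b else 0))) $ i
    = A $$ (i, s) * a + A $$ (i, d) * b" (is "(_ *\<^sub>v ?v) $ _ = _")
proof -
  have "(A *\<^sub>v ?v) $ i = (\<Sum>j<n. A $$ (i, j) * ?v $ j)" using assms by (intro mat_vec_sum) auto
  also have "\<dots> = (\<Sum>j\<in>{s, d}. A $$ (i, j) * ?v $ j)"
    using assms by (intro sum.mono_neutral_right) auto
  finally show ?thesis using assms by simp
qed

lemma quad_form_two:
  assumes "A \<in> carrier_mat n n" "s < n" "d < n" "s \<noteq> d"
  shows "quad_form A (vec n (\<lambda>j. if j = s then a else if j = d then b else 0))
    = (A $$ (s, s) * a + A $$ (s, d) * b) * cnj a + (A $$ (d, s) * a + A $$ (d, d) * b) * cnj b"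
    (is "quad_form A ?v = _")
proof -
  have "quad_form A ?v = (\<Sum>i<n. (A *\<^sub>v ?v) $ i * cnj (?v $ i))"
    using assms by (intro quad_form_sum) auto
  also have "\<dots> = (\<Sum>i\<in>{s, d}. (A *\<^sub>v ?v) $ i * cnj (?v $ i))"
    using assms by (intro sum.mono_neutral_right) auto
  finally show ?thesis using assms mat_vec_two[OF assms(1)] by simp
qed

lemma psd_herm:
  assumes "psd_mat A" "A \<in> carrier_mat n n"
  shows "herm n A"
  using assms by (simp add: psd_mat_def herm_def)

lemma psd_diag:
  assumes A: "psd_mat A" "A \<in> carrier_mat n n" and i: "i < n"
  shows "A $$ (i, i) = of_real (Re (A $$ (i, i)))" "0 \<le> Re (A $$ (i, i))"
proof -
  show "A $$ (i, i) = of_real (Re (A $$ (i, i)))"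
    using hermD(4)[OF psd_herm[OF A] i i] by (simp add: complex_eq_iff)
  let ?v = "unit_vec n i :: complex vec"
  have "quad_form A ?v = (\<Sum>k<n. (A *\<^sub>v ?v) $ k * cnj (?v $ k))"
    by (rule quad_form_sum) (use A in auto)
  also have "\<dots> = (\<Sum>k\<in>{i}. (A *\<^sub>v ?v) $ k * cnj (?v $ k))"
    using i by (intro sum.mono_neutral_right) auto
  also have "\<dots> = A $$ (i, i)" using i A(2) by (simp add: mat_vec_sum)
  finally show "0 \<le> Re (A $$ (i, i))" using A unfolding psd_mat_def by (metis carrier_matD(1) unit_vec_carrier)
qed

lemma psd_minor:
  assumes A: "psd_mat A" "A \<in> carrier_mat n n" and sd: "s < n" "d < n" "s \<noteq> d"
  shows "(cmod (A $$ (s, d)))\<^sup>2 \<le> Re (A $$ (s, s)) * Re (A $$ (d, d))"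
proof -
  define p q z where "p = Re (A $$ (s, s))" and "q = Re (A $$ (d, d))" and "z = A $$ (s, d)"
  have ds: "A $$ (d, s) = cnj z" unfolding z_def using hermD(4)[OF psd_herm[OF A] sd(2,1)] by simp
  have pq: "A $$ (s, s) = of_real p" "A $$ (d, d) = of_real q" "0 \<le> p" "0 \<le> q"
    unfolding p_def q_def using psd_diag[OF A] sd by simp_all
  have zz: "z * cnj z = of_real ((cmod z)\<^sup>2)" by (metis complex_norm_square)
  then have zz': "z * (cnj z * w) = of_real ((cmod z)\<^sup>2) * w" for w
    by (simp only: mult.assoc[symmetric])
  \<comment> \<open>The factor \<open>cnj z\<close> in the second coordinate cancels the phase of
    the off-diagonal entry, leaving a real quadratic form in \<open>a\<close> and
    \<open>b\<close>.\<close>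
  have *: "0 \<le> p * a\<^sup>2 + 2 * a * b * (cmod z)\<^sup>2 + q * b\<^sup>2 * (cmod z)\<^sup>2" for a b :: real
  proof -
    let ?v = "vec n (\<lambda>j. if j = s then of_real a else if j = d then of_real b * cnj z else 0)"
    have "quad_form A ?v = of_real (p * a\<^sup>2 + 2 * a * b * (cmod z)\<^sup>2 + q * b\<^sup>2 * (cmod z)\<^sup>2)"
      using quad_form_two[OF A(2) sd, of "of_real a" "of_real b * cnj z"]
      by (simp add: ds pq z_def[symmetric] zz zz' power2_eq_square algebra_simps)
    moreover have "0 \<le> Re (quad_form A ?v)" using A unfolding psd_mat_def by auto
    ultimately show ?thesis by simp
  qed
  have "(cmod z)\<^sup>2 \<le> p * q"
  proof (cases "q = 0")
    case False
    \<comment> \<open>The vector is, up to sign, a column of the adjugate of the 2x2 block, so the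
      form takes the value \<open>q\<close> times the minor.\<close>
    have "0 \<le> q * (p * q - (cmod z)\<^sup>2)"
      using *[of q "-1"] by (simp add: power2_eq_square algebra_simps)
    then show ?thesis using False pq(4) by (simp add: zero_le_mult_iff)
  next
    case True
    have "z = 0"
    proof (rule ccontr)
      assume "z \<noteq> 0"
      then have "0 < (cmod z)\<^sup>2" by simp
      \<comment> \<open>With \<open>q = 0\<close> the form is affine in \<open>b\<close>; this
        choice makes it \<open>p - 2 * (p + 1)\<close>, which is negative.\<close>
      moreover have "0 \<le> p + 2 * (- ((p + 1) / (cmod z)\<^sup>2)) * (cmod z)\<^sup>2"
        using *[of 1 "- ((p+1) / (cmod z)\<^sup>2)"] True by simp
      ultimately show False using pq(3) by simp
    qed
    then show ?thesis using True by simp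
  qed
  then show ?thesis unfolding p_def q_def z_def .
qed

lemma quad_form_add_smult:
  fixes t :: real
  assumes A: "herm n A" and x: "x \<in> carrier_vec n" and y: "y \<in> carrier_vec n"
  shows "Re (quad_form A (x + of_real t \<cdot>\<^sub>v y))
    = Re (quad_form A x) + 2 * t * Re ((A *\<^sub>v x) \<bullet>c y) + t\<^sup>2 * Re (quad_form A y)"
proof -
  note c = hermD(1)[OF A]
  have s: "(A *\<^sub>v w) \<bullet>c v = (\<Sum>i<n. \<Sum>j<n. A $$ (i, j) * w $ j * cnj (v $ i))"
    if "w \<in> carrier_vec n" "v \<in> carrier_vec n" for w v
    using that c by (auto simp: scalar_prod_def sum_distrib_right atLeast0LessThan)
  have "cnj ((A *\<^sub>v x) \<bullet>c y) = (\<Sum>i<n. \<Sum>j<n. A $$ (j, i) * cnj (x $ j) * y $ i)"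
    using x y by (simp add: s cnj_sum hermD(4)[OF A])
  also have "\<dots> = (A *\<^sub>v y) \<bullet>c x"
    unfolding s[OF y x] by (subst sum.swap) (simp add: mult.commute mult.left_commute)
  finally have yx: "(A *\<^sub>v y) \<bullet>c x = cnj ((A *\<^sub>v x) \<bullet>c y)" by simp
  have "quad_form A (x + of_real t \<cdot>\<^sub>v y)
    = (A *\<^sub>v x) \<bullet>c x + t * ((A *\<^sub>v x) \<bullet>c y) + t * ((A *\<^sub>v y) \<bullet>c x) + t^2 * ((A *\<^sub>v y) \<bullet>c y)"
    unfolding quad_form_def using x y
    by (simp add: s distrib_left distrib_right sum.distrib sum_distrib_left power2_eq_square mult_ac)
  then show ?thesis unfolding yx quad_form_def by (simp flip: of_real_power)
qed

text \<open>A zero of a nonnegative form is a minimum, so the derivative at \<open>x\<close> in the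
  direction \<open>A x\<close>, which is twice the squared norm of \<open>A x\<close>, must
  vanish.\<close>

lemma psd_null_vector:
  assumes A: "psd_mat A" "A \<in> carrier_mat n n" and x: "x \<in> carrier_vec n"
    and null: "Re (quad_form A x) = 0"
  shows "A *\<^sub>v x = 0\<^sub>v n"
proof -
  define y where "y = A *\<^sub>v x"
  have y: "y \<in> carrier_vec n" unfolding y_def using A x by simp
  define m q where "m = Re (y \<bullet>c y)" and "q = Re (quad_form A y)"
  have *: "0 \<le> 2 * t * m + t\<^sup>2 * q" for t :: real
  proof -
    have "0 \<le> Re (quad_form A (x + of_real t \<cdot>\<^sub>v y))"
      using A x y unfolding psd_mat_def by auto
    then show ?thesis
      using quad_form_add_smult[OF psd_herm[OF A] x y, of t] null by (simp add: y_def m_def q_def)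
  qed
  have "0 \<le> q" using A y unfolding psd_mat_def q_def by auto
  have "0 \<le> y \<bullet>c y" by auto
  then have m: "0 \<le> m" "y \<bullet>c y = of_real m" by (auto simp: m_def less_eq_complex_def complex_eq_iff)
  have "m = 0"
  proof -
    \<comment> \<open>Near the minimizer of 2 t m + t^2 q, with \<open>q + 1\<close> in place of
      \<open>q\<close> to allow \<open>q = 0\<close>.\<close>
    define t where "t = - m / (q + 1)"
    have t: "t * (q + 1) = - m" using \<open>0 \<le> q\<close> by (simp add: t_def)
    have "2 * t * m + t\<^sup>2 * q = - (t\<^sup>2) * (q + 2)"
    proof -
      have "m = - (t * (q + 1))" using t by simp
      then have "2 * t * m + t\<^sup>2 * q = 2 * t * - (t * (q + 1)) + t\<^sup>2 * q" by (simp only:)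
      then show ?thesis by (simp add: power2_eq_square algebra_simps)
    qed
    with *[of t] have "t\<^sup>2 * (q + 2) \<le> 0" by simp
    then have "t = 0" using \<open>0 \<le> q\<close> by (simp add: mult_le_0_iff)
    then show ?thesis using t by simp
  qed
  then have "y \<bullet>c y = 0" using m by simp
  then show ?thesis using y unfolding y_def by (simp only: conjugate_square_eq_0_vec)
qed

text \<open>Tightness makes the form vanish at the vector with \<open>q\<close> at \<open>s\<close>
  and \<open>- cnj z\<close> at \<open>d\<close>, so \<open>A\<close> annihilates it; row
  \<open>i\<close> of that equation is the claim.\<close>

lemma psd_tight_minor_columns:
  assumes A: "psd_mat A" "A \<in> carrier_mat n n" and sd: "s < n" "d < n" "s \<noteq> d" and i: "i < n"
    and tight: "(cmod (A $$ (s, d)))\<^sup>2 = Re (A $$ (s, s)) * Re (A $$ (d, d))"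
  shows "A $$ (d, d) * A $$ (i, s) = A $$ (d, s) * A $$ (i, d)"
proof -
  define p q z where "p = Re (A $$ (s, s))" and "q = Re (A $$ (d, d))" and "z = A $$ (s, d)"
  have ds: "A $$ (d, s) = cnj z" unfolding z_def using hermD(4)[OF psd_herm[OF A] sd(2,1)] by simp
  have pq: "A $$ (s, s) = of_real p" "A $$ (d, d) = of_real q"
    unfolding p_def q_def using psd_diag[OF A] sd by simp_all
  have zz: "z * cnj z = of_real p * of_real q"
    using tight unfolding complex_norm_square[symmetric] p_def q_def z_def by (metis of_real_mult of_real_power)
  let ?v = "vec n (\<lambda>j. if j = s then of_real q else if j = d then - cnj z else 0)"
  have "quad_form A ?v = 0"
    using quad_form_two[OF A(2) sd, of "of_real q" "- cnj z"] zz
    by (simp add: ds pq z_def[symmetric] algebra_simps)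
  then have "A *\<^sub>v ?v = 0\<^sub>v n" using psd_null_vector[OF A, of ?v] by simp
  then have "(A *\<^sub>v ?v) $ i = 0" using i by simp
  then show ?thesis using mat_vec_two[OF A(2) i sd] by (simp add: pq ds algebra_simps)
qed

lemma rank_eq_1I:
  fixes A :: "complex mat"
  assumes A: "A \<in> carrier_mat n m" and nz: "A \<noteq> 0\<^sub>m n m"
    and prod: "\<And>i j. i < n \<Longrightarrow> j < m \<Longrightarrow> A $$ (i, j) = f i * g j"
  shows "vec_space.rank n A = 1"
proof -
  interpret vec_space "TYPE(complex)" n .
  have "rank A \<le> 1" by (rule rank_le_1_product_entries[OF A, of f g]) (use prod A in auto)
  moreover have "rank A \<ge> 1"
  proof -
    obtain i j where ij: "i < n" "j < m" "A $$ (i, j) \<noteq> 0"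
      using nz A by (auto simp: mat_eq_iff)
    have c: "col A j \<in> carrier_vec n" using A by auto
    moreover have "col A j \<noteq> 0\<^sub>v n"
    proof
      assume "col A j = 0\<^sub>v n"
      then have "col A j $ i = 0" using ij by simp
      then show False using ij A by simp
    qed
    ultimately have "lin_indpt {col A j}"
      using lin_dep_iff_in_span[of "{}" "col A j"] by (auto simp: span_empty lin_dep_def[of "{}"])
    then show ?thesis using rank_ge_card_indpt[OF A, of "{col A j}"] ij A
      by (auto simp: cols_def)
  qed
  ultimately show ?thesis by simp
qed

section \<open>Traces\<close>

lemma trace_mult:
  assumes "A \<in> carrier_mat n n" "D \<in> carrier_mat n n"
  shows "mat_trace (A * D) = (\<Sum>i<n. \<Sum>j<n. A $$ (i, j) * D $$ (j, i))"
  using assms by (auto simp: mat_trace_def scalar_prod_def atLeast0LessThan)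

lemma trace_add_mult:
  assumes A: "A \<in> carrier_mat n n" and B: "B \<in> carrier_mat n n" and D: "(D :: complex mat) \<in> carrier_mat n n"
  shows "mat_trace ((A + B) * D) = mat_trace (A * D) + mat_trace (B * D)"
  unfolding trace_mult[OF A D] trace_mult[OF B D] trace_mult[OF add_carrier_mat[OF B] D]
  using A B by (simp add: distrib_right sum.distrib)

lemma trace_minus_mult:
  assumes A: "A \<in> carrier_mat n n" and B: "B \<in> carrier_mat n n" and D: "(D :: complex mat) \<in> carrier_mat n n"
  shows "mat_trace ((A - B) * D) = mat_trace (A * D) - mat_trace (B * D)"
  unfolding trace_mult[OF A D] trace_mult[OF B D] trace_mult[OF minus_carrier_mat[OF B] D]
  using A B by (simp add: left_diff_distrib sum_subtractf)

lemma trace_uminus_mult: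
  assumes A: "A \<in> carrier_mat n n" and D: "(D :: complex mat) \<in> carrier_mat n n"
  shows "mat_trace (- A * D) = - mat_trace (A * D)"
  unfolding trace_mult[OF A D] trace_mult[OF uminus_carrier_mat[OF A] D]
  using A by (simp add: sum_negf)

lemma trace_smult_mult:
  assumes "A \<in> carrier_mat n n" "(D :: complex mat) \<in> carrier_mat n n"
  shows "mat_trace (a \<cdot>\<^sub>m A * D) = a * mat_trace (A * D)"
  using assms by (auto simp: trace_mult[of _ n] sum_distrib_left mult.assoc)

lemma trace_sum_mats_mult:
  assumes "\<And>k. k \<in> I \<Longrightarrow> F k \<in> carrier_mat n n" "(D :: complex mat) \<in> carrier_mat n n"
  shows "mat_trace (sum_mats n n F I * D) = (\<Sum>k\<in>I. mat_trace (F k * D))"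
proof -
  have "mat_trace (sum_mats n n F I * D) = (\<Sum>i<n. \<Sum>j<n. \<Sum>k\<in>I. F k $$ (i, j) * D $$ (j, i))"
    using assms(2) by (subst trace_mult[of _ n]) (auto simp: sum_mats_def sum_distrib_right)
  also have "\<dots> = (\<Sum>k\<in>I. \<Sum>i<n. \<Sum>j<n. F k $$ (i, j) * D $$ (j, i))"
    unfolding sum.swap[of _ I "{..<n}"] ..
  also have "\<dots> = (\<Sum>k\<in>I. mat_trace (F k * D))"
    using assms by (intro sum.cong) (auto simp: trace_mult[of _ n])
  finally show ?thesis .
qed

lemma trace_adjoint_mult:
  assumes A: "A \<in> carrier_mat n n" and D: "herm n D"
  shows "mat_trace (mat_adjoint A * D) = cnj (mat_trace (A * D))"
proof -
  have "mat_trace (mat_adjoint A * D) = (\<Sum>i<n. \<Sum>j<n. cnj (A $$ (j, i)) * D $$ (j, i))"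
    using A hermD(1)[OF D]
    by (subst trace_mult[of _ n]) (auto simp: dim_mat_adjoint index_mat_adjoint intro!: carrier_matI)
  also have "\<dots> = (\<Sum>j<n. \<Sum>i<n. cnj (A $$ (j, i)) * D $$ (j, i))"
    by (rule sum.swap)
  also have "\<dots> = cnj (mat_trace (A * D))"
    using A hermD(1)[OF D] by (subst trace_mult[of _ n]) (auto simp: hermD(4)[OF D])
  finally show ?thesis .
qed

text \<open>This is the shape of \<open>S_mat\<close> and of both summands of
  \<open>S_branch_mat\<close>.\<close>

lemma trace_adjoint_outer_mult:
  assumes B: "B \<in> carrier_mat m n" and D: "D \<in> carrier_mat n n" and ks: "k < m" "s < n"
  shows "mat_trace (mat_adjoint B * outer (unit_vec m k) (unit_vec n s) * D)
    = (\<Sum>i<n. cnj (B $$ (k, i)) * D $$ (s, i))"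
proof -
  let ?S = "mat_adjoint B * outer (unit_vec m k) (unit_vec n s)"
  have S: "?S \<in> carrier_mat n n"
    using B by (intro carrier_matI) (auto simp: dim_mat_adjoint outer_def)
  have e: "?S $$ (i, j) = (if j = s then cnj (B $$ (k, i)) else 0)" if "i < n" "j < n" for i j
    using B ks that
    by (simp add: scalar_prod_def outer_def unit_vec_def dim_mat_adjoint index_mat_adjoint
        if_distrib[of "\<lambda>x. _ * x"] cong: if_cong)
  show ?thesis
    unfolding trace_mult[OF S D] using ks
    by (intro sum.cong) (auto simp: e if_distrib[of "\<lambda>x. x * _"] cong: if_cong)
qed

lemma trace_outer_unit_mult:
  assumes D: "(D :: complex mat) \<in> carrier_mat n n" and ab: "a < n" "b < n"
  shows "mat_trace (outer (unit_vec n a) (unit_vec n b) * D) = D $$ (b, a)"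
proof -
  have O: "outer (unit_vec n a) (unit_vec n b) \<in> carrier_mat n n"
    by (intro carrier_matI) (auto simp: outer_def)
  have "mat_trace (outer (unit_vec n a) (unit_vec n b) * D)
      = (\<Sum>i<n. \<Sum>j<n. if j = b then if i = a then D $$ (b, a) else 0 else 0)"
    unfolding trace_mult[OF O D]
    by (intro sum.cong) (auto simp: outer_def unit_vec_def)
  then show ?thesis using ab by simp
qed

text \<open>Used for the current matrices: a row of \<open>Y_src\<close> or \<open>Y_dst\<close>
  meets only the two ends of its branch, and with a zero diagonal of \<open>D\<close> only two
  conjugate cross terms survive.\<close>

lemma trace_gram_mult:
  assumes B: "B \<in> carrier_mat m n" "k < m" and D: "herm n D"
    and row: "\<And>j. j < n \<Longrightarrow> B $$ (k, j) = (if j = s then a else 0) + (if j = d then b else 0)"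
    and sd: "s < n" "d < n" and diag: "D $$ (s, s) = 0" "D $$ (d, d) = 0"
  shows "Re (mat_trace (mat_adjoint B * outer (unit_vec m k) (unit_vec m k) * B * D))
    = 2 * Re (cnj a * b * D $$ (d, s))"
proof -
  have two: "(\<Sum>j<n. ((if j = s then x else 0) + (if j = d then y else 0)) * f j) = x * f s + y * f d"
    for x y :: complex and f
    using sd by (simp add: distrib_right sum.distrib if_distrib[of "\<lambda>x. x * _"] cong: if_cong)
  have "mat_trace (mat_adjoint B * outer (unit_vec m k) (unit_vec m k) * B * D)
      = (\<Sum>i<n. cnj (B $$ (k, i)) * (\<Sum>j<n. B $$ (k, j) * D $$ (j, i)))"
    unfolding mult_outer_unit[OF B] using hermD(1)[OF D]
    by (subst trace_mult[of _ n]) (auto simp: sum_distrib_left mult.assoc)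
  also have "\<dots> = (\<Sum>i<n. ((if i = s then cnj a else 0) + (if i = d then cnj b else 0))
      * (a * D $$ (s, i) + b * D $$ (d, i)))"
    by (rule sum.cong) (auto simp: row two)
  also have "\<dots> = cnj a * b * D $$ (d, s) + cnj (cnj a * b * D $$ (d, s))"
    unfolding two using diag hermD(4)[OF D sd] by simp
  finally show ?thesis by (simp only: plus_complex.sel cnj.sel mult_2)
qed

section \<open>Shifting the edge entries\<close>

text \<open>A shunt admittance \<open>z\<close> no larger than the series admittance
  \<open>y\<close> cannot outweigh the term |y|^2. This fixes the sign in the current
  constraints.\<close>

lemma Re_cnj_add_mult_nonneg:
  assumes "cmod z \<le> cmod y"
  shows "0 \<le> Re (cnj (y + z) * y)"
proof -
  have "\<bar>Re (cnj z * y)\<bar> \<le> cmod (cnj z * y)" by (rule abs_Re_le_cmod)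
  also have "\<dots> \<le> cmod y * cmod y" using assms by (simp add: norm_mult mult_right_mono)
  also have "\<dots> = Re (cnj y * y)" by (simp add: power2_eq_square[symmetric] cmod_power2)
  finally show ?thesis by (simp add: algebra_simps)
qed

lemma sum_outer_unit:
  fixes w :: "nat \<Rightarrow> complex vec"
  assumes "\<And>k. dim_vec (w k) = nc" "i < nr" "j < nc"
  shows "sum_mats nr nc (\<lambda>k. outer (unit_vec nr k) (w k)) {..<nr} $$ (i, j) = w i $ j"
proof -
  have "sum_mats nr nc (\<lambda>k. outer (unit_vec nr k) (w k)) {..<nr} $$ (i, j)
      = (\<Sum>k<nr. outer (unit_vec nr k) (w k) $$ (i, j))"
    using assms by (simp add: sum_mats_def)
  also have "\<dots> = (\<Sum>k<nr. if k = i then w i $ j else 0)"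
    using assms by (intro sum.cong) (auto simp: outer_def)
  finally show ?thesis using assms by simp
qed

text \<open>Every constraint function is weakly, and the objective strictly, decreasing when the entry
  of a Hermitian matrix that belongs to a branch \<open>k\<close> is moved in the direction \<open>\<rho>\<^sub>k\<close>.\<close>

locale edge_shift =
  fixes G :: grid and \<tau> :: "nat \<Rightarrow> real" and D :: "complex mat"
  assumes grid: "valid_grid G"
    and herm: "herm (NV G) D"
    and diag: "n < NV G \<Longrightarrow> D $$ (n, n) = 0"
    and edge: "k < NE G \<Longrightarrow> D $$ (ac_src G k, ac_dst G k) = of_real (\<tau> k) * rho G k"
    and nonneg: "k < NE G \<Longrightarrow> 0 \<le> \<tau> k"
begin

text \<open>The amount by which the shift of branch \<open>k\<close> lowers the complex power at
  each of its two ends. The admittance is conjugated because the power matrices contain adjoints of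
  admittance matrices; this turns \<open>Im (y_series G k)\<close> \<le> 0 into a nonnegative
  imaginary part.\<close>

definition gain :: "nat \<Rightarrow> complex" where
  "gain k = of_real (\<tau> k * (cmod (rho G k))\<^sup>2) * cnj (y_series G k)"

lemma D_carrier: "D \<in> carrier_mat (NV G) (NV G)"
  by (rule hermD(1)[OF herm])

lemma ends:
  assumes "k < NE G"
  shows "ac_src G k < NV G" "ac_dst G k < NV G" "ac_src G k \<noteq> ac_dst G k"
  using grid assms by (auto simp: valid_grid_def valid_topology_def)

lemma edge':
  assumes "k < NE G"
  shows "D $$ (ac_dst G k, ac_src G k) = of_real (\<tau> k) * cnj (rho G k)"
  using hermD(4)[OF herm ends(2)[OF assms] ends(1)[OF assms]] edge[OF assms] by simp

lemma gain_eq: "of_real (\<tau> k) * (rho G k * (cnj (rho G k) * cnj (y_series G k))) = gain k"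
  by (simp only: gain_def of_real_mult complex_norm_square mult.assoc)

lemma Re_gain: "k < NE G \<Longrightarrow> 0 \<le> Re (gain k)"
  and Im_gain: "k < NE G \<Longrightarrow> 0 \<le> Im (gain k)"
  using grid nonneg[of k] mult_nonneg_nonneg[of "\<tau> k * (cmod (rho G k))\<^sup>2" "Re (y_series G k)"]
  by (auto simp: gain_def valid_grid_def valid_branches_def mult_nonneg_nonpos)

text \<open>The \<open>alpha_bus\<close> term meets the zero diagonal of \<open>D\<close>. At either
  end, the factor \<rho> or its conjugate in the entry of \<open>D\<close> is paired with the
  opposite one from the conjugated \<beta>, so both ends lose the same \<open>gain\<close>.\<close>

lemma trace_S:
  assumes n: "n < NV G"
  shows "mat_trace (S_mat G n * D)
    = - (\<Sum>k | k < NE G \<and> ac_src G k = n. gain k) - (\<Sum>k | k < NE G \<and> ac_dst G k = n. gain k)"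
proof -
  let ?s = "{k. k < NE G \<and> ac_src G k = n}" and ?d = "{k. k < NE G \<and> ac_dst G k = n}"
  have row: "Y_mat G $$ (n, j) = (if j = n then alpha_bus G n else 0)
      + (\<Sum>k\<in>?s. if j = ac_dst G k then beta_src G k else 0)
      + (\<Sum>k\<in>?d. if j = ac_src G k then beta_dst G k else 0)" if "j < NV G" for j
    unfolding Y_mat_def using n that
    by (subst sum_outer_unit)
      (auto simp: sum_vecs_def unit_vec_def intro!: sum.cong arg_cong2[of _ _ _ _ "(+)"])
  have "mat_trace (S_mat G n * D) = (\<Sum>j<NV G. cnj (Y_mat G $$ (n, j)) * D $$ (n, j))"
    unfolding S_mat_def by (rule trace_adjoint_outer_mult[OF carrier_Y(3) D_carrier n n])
  also have "\<dots> = (\<Sum>j<NV G. (if j = n then cnj (alpha_bus G n) * D $$ (n, n) else 0)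
      + (\<Sum>k\<in>?s. if j = ac_dst G k then cnj (beta_src G k) * D $$ (n, ac_dst G k) else 0)
      + (\<Sum>k\<in>?d. if j = ac_src G k then cnj (beta_dst G k) * D $$ (n, ac_src G k) else 0))"
    by (intro sum.cong refl)
      (auto simp: row distrib_right sum_distrib_right if_distrib[of cnj] intro!: sum.cong arg_cong2[of _ _ _ _ "(+)"])
  also have "\<dots> = (\<Sum>k\<in>?s. cnj (beta_src G k) * D $$ (n, ac_dst G k))
      + (\<Sum>k\<in>?d. cnj (beta_dst G k) * D $$ (n, ac_src G k))"
    \<comment> \<open>After exchanging the sums, each branch selects the single column of its other
      end.\<close>
    unfolding sum.distrib sum.swap[of _ ?s] sum.swap[of _ ?d]
    using n diag by (auto simp: ends intro!: sum.cong arg_cong2[of _ _ _ _ "(+)"])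
  also have "\<dots> = (\<Sum>k\<in>?s. - gain k) + (\<Sum>k\<in>?d. - gain k)"
    by (intro arg_cong2[of _ _ _ _ "(+)"] sum.cong)
      (auto simp: edge edge' beta_src_def beta_dst_def gain_eq[symmetric] mult_ac)
  finally show ?thesis by (simp add: sum_negf)
qed

lemma Y_src_row:
  assumes "k < NE G" "j < NV G"
  shows "Y_src G $$ (k, j)
    = (if j = ac_src G k then alpha_src G k else 0) + (if j = ac_dst G k then beta_src G k else 0)"
  unfolding Y_src_def using assms by (subst sum_outer_unit) (auto simp: unit_vec_def)

lemma Y_dst_row:
  assumes "k < NE G" "j < NV G"
  shows "Y_dst G $$ (k, j)
    = (if j = ac_dst G k then alpha_dst G k else 0) + (if j = ac_src G k then beta_dst G k else 0)"
  unfolding Y_dst_def using assms by (subst sum_outer_unit) (auto simp: unit_vec_def)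

lemma trace_S_branch:
  assumes k: "k < NE G"
  shows "mat_trace (S_branch_mat G k * D) = - 2 * gain k"
proof -
  let ?s = "ac_src G k" and ?d = "ac_dst G k"
  note e = ends[OF k]
  have two: "(\<Sum>j<NV G. cnj ((if j = s then x else 0) + (if j = d then y else 0)) * f j)
      = cnj x * f s + cnj y * f d"
    if "s < NV G" "d < NV G" for s d x y f
    using that by (simp add: distrib_right sum.distrib if_distrib[of cnj]
      if_distrib[of "\<lambda>x. x * _"] cong: if_cong)
  have "mat_trace (S_branch_mat G k * D) = (\<Sum>j<NV G. cnj (Y_src G $$ (k, j)) * D $$ (?s, j))
      + (\<Sum>j<NV G. cnj (Y_dst G $$ (k, j)) * D $$ (?d, j))"
    unfolding S_branch_mat_def
    unfolding trace_adjoint_outer_mult[OF carrier_Y(1) D_carrier k e(1), symmetric]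
      trace_adjoint_outer_mult[OF carrier_Y(2) D_carrier k e(2), symmetric]
    by (rule trace_add_mult[OF _ _ D_carrier])
      (auto simp: dim_mat_adjoint outer_def carrier_matD[OF carrier_Y(1)] carrier_matD[OF carrier_Y(2)])
  also have "(\<Sum>j<NV G. cnj (Y_src G $$ (k, j)) * D $$ (?s, j)) = - gain k"
    using two[OF e(1,2), of _ _ "\<lambda>j. D $$ (?s, j)"] e k
    by (simp add: Y_src_row diag edge beta_src_def gain_eq[symmetric] mult_ac)
  also have "(\<Sum>j<NV G. cnj (Y_dst G $$ (k, j)) * D $$ (?d, j)) = - gain k"
    using two[OF e(2,1), of _ _ "\<lambda>j. D $$ (?d, j)"] e k
    by (simp add: Y_dst_row diag edge' beta_dst_def gain_eq[symmetric] mult_ac)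
  finally show ?thesis by simp
qed

text \<open>Since \<open>D\<close> is Hermitian, replacing \<open>S\<close> by its adjoint
  conjugates the trace, so the two Hermitian combinations extract real and imaginary part.\<close>

lemma trace_P_Q:
  assumes S: "S \<in> carrier_mat (NV G) (NV G)"
  shows "Re (mat_trace ((1 / 2) \<cdot>\<^sub>m (S + mat_adjoint S) * D)) = Re (mat_trace (S * D))"
    and "Re (mat_trace ((1 / (2 * \<i>)) \<cdot>\<^sub>m (S - mat_adjoint S) * D)) = Im (mat_trace (S * D))"
proof -
  have a: "mat_adjoint S \<in> carrier_mat (NV G) (NV G)"
    using S by (intro carrier_matI) (auto simp: dim_mat_adjoint)
  show "Re (mat_trace ((1 / 2) \<cdot>\<^sub>m (S + mat_adjoint S) * D)) = Re (mat_trace (S * D))"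
    using S a D_carrier
    by (simp add: trace_smult_mult[of _ "NV G"] trace_add_mult[of _ "NV G"] trace_adjoint_mult[OF S herm])
  have "mat_trace ((1 / (2 * \<i>)) \<cdot>\<^sub>m (S - mat_adjoint S) * D)
      = 1 / (2 * \<i>) * (mat_trace (S * D) - cnj (mat_trace (S * D)))"
    using S a D_carrier
    by (simp add: trace_smult_mult[of _ "NV G"] trace_minus_mult[of _ "NV G"] minus_carrier_mat
      trace_adjoint_mult[OF S herm])
  then show "Re (mat_trace ((1 / (2 * \<i>)) \<cdot>\<^sub>m (S - mat_adjoint S) * D)) = Im (mat_trace (S * D))"
    by (simp add: complex_diff_cnj)
qed

lemma trace_P: "n < NV G \<Longrightarrow> Re (mat_trace (P_mat G n * D)) \<le> 0"
  and trace_Q: "n < NV G \<Longrightarrow> Re (mat_trace (Q_mat G n * D)) \<le> 0"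
  unfolding P_mat_def Q_mat_def trace_P_Q[OF carrier_S(1)]
  using Re_gain Im_gain
    sum_nonneg[of "{k. k < NE G \<and> ac_src G k = n}" "\<lambda>k. Re (gain k)"]
    sum_nonneg[of "{k. k < NE G \<and> ac_dst G k = n}" "\<lambda>k. Re (gain k)"]
    sum_nonneg[of "{k. k < NE G \<and> ac_src G k = n}" "\<lambda>k. Im (gain k)"]
    sum_nonneg[of "{k. k < NE G \<and> ac_dst G k = n}" "\<lambda>k. Im (gain k)"]
  by (simp_all add: trace_S)

lemma trace_M: "n < NV G \<Longrightarrow> mat_trace (M_mat G n * D) = 0"
  unfolding M_mat_def using trace_outer_unit_mult[OF D_carrier] diag by simp

lemma rho_pos:
  assumes k: "k < NE G"
  shows "0 < Re (rho G k)"
    and "tan (delta_lo G k) * Re (rho G k) + Im (rho G k) \<le> 0"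
    and "0 \<le> tan (delta_up G k) * Re (rho G k) + Im (rho G k)"
proof -
  have b: "- pi / 2 < delta_lo G k" "delta_lo G k \<le> - Arg (rho G k)"
    "- Arg (rho G k) \<le> delta_up G k" "delta_up G k < pi / 2" "rho G k \<noteq> 0"
    using grid k by (auto simp: valid_grid_def valid_bounds_def valid_branches_def rho_def)
  define a r where "a = Arg (rho G k)" and "r = cmod (rho G k)"
  have r: "0 < r" using b by (simp add: r_def)
  have "rho G k = rcis r a" unfolding a_def r_def by (simp add: rcis_cmod_Arg)
  then have ri: "Re (rho G k) = r * cos a" "Im (rho G k) = r * sin a" by simp_all
  have c: "0 < cos a" using b by (intro cos_gt_zero_pi) (auto simp: a_def)
  show pos: "0 < Re (rho G k)" using c r ri by simp
  \<comment> \<open>In this form both angle conditions reduce to monotonicity of \<open>tan\<close>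
    between - pi / 2 and pi / 2, where \<open>- a\<close> lies between the two bounds.\<close>
  have t: "Im (rho G k) = - tan (- a) * Re (rho G k)" using c ri by (simp add: tan_def)
  have "tan (delta_lo G k) \<le> tan (- a)"
    using b by (intro tan_mono_le) (auto simp: a_def)
  then show "tan (delta_lo G k) * Re (rho G k) + Im (rho G k) \<le> 0"
    unfolding t using mult_right_mono[of _ _ "Re (rho G k)"] pos by fastforce
  have "tan (- a) \<le> tan (delta_up G k)"
    using b by (intro tan_mono_le) (auto simp: a_def)
  then show "0 \<le> tan (delta_up G k) * Re (rho G k) + Im (rho G k)"
    unfolding t using mult_right_mono[of _ _ "Re (rho G k)"] pos by fastforce
qed

lemma trace_M_cross:
  assumes k: "k < NE G"
  shows "mat_trace (M_cross_mat G k * D) = of_real (\<tau> k) * cnj (rho G k)"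
    and "mat_trace (mat_adjoint (M_cross_mat G k) * D) = of_real (\<tau> k) * rho G k"
proof -
  show *: "mat_trace (M_cross_mat G k * D) = of_real (\<tau> k) * cnj (rho G k)"
    unfolding M_cross_mat_def using trace_outer_unit_mult[OF D_carrier] ends[OF k] edge'[OF k] by simp
  show "mat_trace (mat_adjoint (M_cross_mat G k) * D) = of_real (\<tau> k) * rho G k"
    unfolding trace_adjoint_mult[OF carrier_S(3) herm] * by simp
qed

lemma trace_A:
  assumes k: "k < NE G"
  shows "Re (mat_trace (A_mat G k * D)) \<le> 0" "Re (mat_trace (A_lo_mat G k * D)) \<le> 0"
    "Re (mat_trace (A_up_mat G k * D)) \<le> 0"
proof -
  let ?M = "M_cross_mat G k"
  have a: "mat_adjoint ?M \<in> carrier_mat (NV G) (NV G)"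
    using carrier_S(3)[of G k] by (intro carrier_matI) (auto simp: dim_mat_adjoint)
  note c = carrier_S(3)[of G k] a D_carrier
  note t = trace_smult_mult[of _ "NV G"] trace_minus_mult[of _ "NV G"] trace_add_mult[of _ "NV G"]
    trace_uminus_mult[of _ "NV G"] trace_M_cross[OF k] minus_carrier_mat
  note r = rho_pos[OF k] nonneg[OF k]
  have "Re (mat_trace (A_mat G k * D)) = - 2 * (\<tau> k * Re (rho G k))"
    unfolding A_mat_def using c by (simp add: t del: uminus_mult_left_mat)
  then show "Re (mat_trace (A_mat G k * D)) \<le> 0" using r by simp
  have "Re (mat_trace (A_lo_mat G k * D)) = 2 * (\<tau> k * (tan (delta_lo G k) * Re (rho G k) + Im (rho G k)))"
    unfolding A_lo_mat_def using c by (simp add: t algebra_simps)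
  then show "Re (mat_trace (A_lo_mat G k * D)) \<le> 0" using r by (simp add: mult_nonneg_nonpos)
  have "Re (mat_trace (A_up_mat G k * D)) = - 2 * (\<tau> k * (tan (delta_up G k) * Re (rho G k) + Im (rho G k)))"
    unfolding A_up_mat_def using c by (simp add: t algebra_simps)
  then show "Re (mat_trace (A_up_mat G k * D)) \<le> 0" using r by simp
qed

lemma trace_I:
  assumes k: "k < NE G"
  shows "Re (mat_trace (I_src_mat G k * D)) \<le> 0" "Re (mat_trace (I_dst_mat G k * D)) \<le> 0"
proof -
  note e = ends[OF k]
  let ?\<rho> = "rho G k" and ?y = "y_series G k"
  have y: "cmod (y_src G k) \<le> cmod ?y" "cmod (y_dst G k) \<le> cmod ?y"
    using grid k by (auto simp: valid_grid_def valid_branches_def)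
  \<comment> \<open>One inequality serves both ends: \<open>r\<close> is \<rho> at the source and
    its conjugate at the destination, and \<open>c\<close> is the squared modulus of the voltage
    ratio there.\<close>
  have neg: "2 * Re (cnj (of_real c * (?y + z)) * (- r * ?y) * (of_real (\<tau> k) * cnj r)) \<le> 0"
    if "cmod z \<le> cmod ?y" "0 \<le> c" for c r z
  proof -
    have "cnj (of_real c * (?y + z)) * (- r * ?y) * (of_real (\<tau> k) * cnj r)
        = - of_real (c * \<tau> k * (cmod r)\<^sup>2) * (cnj (?y + z) * ?y)"
      by (simp only: of_real_mult complex_norm_square complex_cnj_mult complex_cnj_complex_of_real)
        (simp only: mult_ac mult_minus_left mult_minus_right)
    moreover have "0 \<le> (c * \<tau> k * (cmod r)\<^sup>2) * Re (cnj (?y + z) * ?y)"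
      using that Re_cnj_add_mult_nonneg[OF that(1)] nonneg[OF k] by simp
    ultimately have "Re (cnj (of_real c * (?y + z)) * (- r * ?y) * (of_real (\<tau> k) * cnj r)) \<le> 0"
      by (simp only: of_real_minus[symmetric] mult_minus_left[symmetric] scaleR_conv_of_real[symmetric]
          scaleR_complex.sel)
    then show ?thesis by (rule mult_nonneg_nonpos[OF zero_le_numeral])
  qed
  show "Re (mat_trace (I_src_mat G k * D)) \<le> 0"
    unfolding I_src_mat_def
    using trace_gram_mult[OF carrier_Y(1) k herm Y_src_row[OF k] e(1,2) diag[OF e(1)] diag[OF e(2)]]
      neg[OF y(1) zero_le_power2, of "cmod (rho_src G k)" ?\<rho>]
    by (simp only: edge'[OF k] alpha_src_def beta_src_def)
  show "Re (mat_trace (I_dst_mat G k * D)) \<le> 0"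
    unfolding I_dst_mat_def
    using trace_gram_mult[OF carrier_Y(2) k herm Y_dst_row[OF k] e(2,1) diag[OF e(2)] diag[OF e(1)]]
      neg[OF y(2) zero_le_power2, of "cmod (rho_dst G k)" "cnj ?\<rho>"]
    by (simp only: edge[OF k] complex_cnj_cnj alpha_dst_def beta_dst_def)
qed

lemma trace_constraint:
  assumes "(C, c, b) \<in> set (opf_constraints G)"
  shows "Re (mat_trace (C * D)) \<le> 0"
proof -
  have M: "M_mat G n \<in> carrier_mat (NV G) (NV G)" for n
    by (rule hermD(1)[OF herm_M_mat])
  have "mat_trace (- M_mat G n * D) = 0" if "n < NV G" for n
    using trace_M[OF that] trace_uminus_mult[OF M D_carrier, of n] by simp
  moreover have "mat_trace (M_lo_mat G k * D) = 0" "mat_trace (M_up_mat G k * D) = 0" if "k < NE G" for k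
    unfolding M_lo_mat_def M_up_mat_def using ends[OF that] M D_carrier
    by (simp_all add: trace_smult_mult[of _ "NV G"] trace_minus_mult[of _ "NV G"] trace_M)
  moreover have "mat_trace (0\<^sub>m (NV G) (NV G) * D) = 0"
    using D_carrier by (simp add: mat_trace_def)
  ultimately show ?thesis
    using assms unfolding opf_constraints_def ac_constraints_def dc_constraints_def
    by (auto simp: trace_M trace_P trace_Q trace_I trace_A)
qed

text \<open>Generation costs cannot rise and every branch contributes a nonpositive change of its
  loss, so keeping branch \<open>k\<close> alone still gives an upper bound. The factor 2 counts its
  two ends.\<close>

lemma trace_objective:
  assumes k: "k < NE G"
  shows "Re (mat_trace (C0_mat G * D))
    \<le> - (2 * loss_weight G * (cmod (rho G k))\<^sup>2 * Re (y_series G k)) * \<tau> k"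
proof -
  have M: "M_mat G n \<in> carrier_mat (NV G) (NV G)" for n
    by (rule hermD(1)[OF herm_M_mat])
  have P: "P_mat G n \<in> carrier_mat (NV G) (NV G)" "P_branch_mat G l \<in> carrier_mat (NV G) (NV G)" for n l
    unfolding P_mat_def P_branch_mat_def by (rule hermD(1)[OF herm_P[OF carrier_S(1)]] hermD(1)[OF herm_P[OF carrier_S(2)]])+
  have sm: "sum_mats (NV G) (NV G) F I \<in> carrier_mat (NV G) (NV G)" for F :: "nat \<Rightarrow> complex mat" and I
    by (simp add: sum_mats_def)
  have w: "0 \<le> cost_weight G" "0 < loss_weight G" "\<And>n. n < NV G \<Longrightarrow> 0 \<le> gen_cost G n"
    using grid by (auto simp: valid_grid_def valid_costs_def)
  have eq: "mat_trace (C0_mat G * D)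
      = cost_weight G * (\<Sum>n<NV G. gen_cost G n * mat_trace (P_mat G n * D))
        + loss_weight G * (\<Sum>l<NE G. mat_trace (P_branch_mat G l * D))"
    unfolding C0_mat_def using M P sm D_carrier
    by (simp add: trace_smult_mult[of _ "NV G"] trace_add_mult[of _ "NV G"]
        trace_sum_mats_mult[of _ _ "NV G"] trace_M)
  have br: "Re (mat_trace (P_branch_mat G l * D)) = - 2 * Re (gain l)" if "l < NE G" for l
    unfolding P_branch_mat_def trace_P_Q[OF carrier_S(2)] trace_S_branch[OF that] by simp
  have "Re (mat_trace (C0_mat G * D))
      = cost_weight G * (\<Sum>n<NV G. gen_cost G n * Re (mat_trace (P_mat G n * D)))
        - loss_weight G * (2 * (\<Sum>l<NE G. Re (gain l)))"
    unfolding eq by (simp add: br sum_distrib_left sum_negf)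
  moreover have "cost_weight G * (\<Sum>n<NV G. gen_cost G n * Re (mat_trace (P_mat G n * D))) \<le> 0"
    using w trace_P by (intro mult_nonneg_nonpos sum_nonpos) auto
  moreover have "Re (gain k) \<le> (\<Sum>l<NE G. Re (gain l))"
    using k Re_gain by (intro member_le_sum) auto
  then have "loss_weight G * (2 * Re (gain k)) \<le> loss_weight G * (2 * (\<Sum>l<NE G. Re (gain l)))"
    using w by simp
  moreover have "Re (gain k) = \<tau> k * (cmod (rho G k))\<^sup>2 * Re (y_series G k)"
    by (simp add: gain_def)
  ultimately show ?thesis by (simp add: mult_ac)
qed

end

section \<open>Improving a feasible point of the relaxation\<close>

lemma quad_form_double:
  assumes "A \<in> carrier_mat n n" "v \<in> carrier_vec n"
  shows "quad_form A v = (\<Sum>i<n. \<Sum>j<n. A $$ (i, j) * v $ j * cnj (v $ i))"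
  unfolding quad_form_sum[OF assms] using assms
  by (auto simp: mat_vec_sum sum_distrib_right simp del: index_mult_mat_vec intro!: sum.cong)

lemma outer_conj:
  assumes "v \<in> carrier_vec n"
  shows "outer v (conjugate v) \<in> carrier_mat n n"
    and "i < n \<Longrightarrow> j < n \<Longrightarrow> outer v (conjugate v) $$ (i, j) = v $ i * cnj (v $ j)"
  using assms by (auto simp: outer_def)

lemma psd_outer_conj:
  assumes v: "v \<in> carrier_vec n"
  shows "psd_mat (outer v (conjugate v))"
proof -
  note c = outer_conj(1)[OF v]
  have h: "herm n (outer v (conjugate v))"
    by (rule hermI[OF c]) (simp add: outer_conj[OF v] mult.commute)
  moreover have "0 \<le> Re (quad_form (outer v (conjugate v)) x)" if x: "x \<in> carrier_vec n" for x
  proof -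
    let ?w = "\<Sum>i<n. v $ i * cnj (x $ i)"
    have "quad_form (outer v (conjugate v)) x = ?w * cnj ?w"
      unfolding quad_form_double[OF c x] cnj_sum sum_product
      by (intro sum.cong refl) (simp add: outer_conj[OF v] mult_ac)
    also have "\<dots> = of_real ((cmod ?w)\<^sup>2)" by (rule complex_norm_square[symmetric])
    finally show ?thesis by simp
  qed
  ultimately show ?thesis using c by (auto simp: psd_mat_def herm_def)
qed

lemma opf_lhs_eq_sdr_lhs:
  assumes C: "C \<in> carrier_mat n n" and v: "v \<in> carrier_vec n"
  shows "opf_lhs C c v p = sdr_lhs C c (outer v (conjugate v)) p"
proof -
  have "mat_trace (C * outer v (conjugate v)) = quad_form C v"
    unfolding trace_mult[OF C outer_conj(1)[OF v]] quad_form_double[OF C v]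
    by (intro sum.cong refl) (simp add: outer_conj[OF v] mult_ac)
  then show ?thesis by (simp add: opf_lhs_def sdr_lhs_def)
qed

definition comb :: "real \<Rightarrow> real \<Rightarrow> complex mat \<Rightarrow> complex mat \<Rightarrow> complex mat" where
  "comb a b V W = of_real a \<cdot>\<^sub>m V + of_real b \<cdot>\<^sub>m W"

lemma comb_matrix:
  assumes "V \<in> carrier_mat n n" "W \<in> carrier_mat n n"
  shows "comb a b V W \<in> carrier_mat n n"
    and "i < n \<Longrightarrow> j < n \<Longrightarrow> comb a b V W $$ (i, j) = of_real a * V $$ (i, j) + of_real b * W $$ (i, j)"
  using assms by (auto simp: comb_def)

lemma psd_comb:
  assumes V: "psd_mat V" "V \<in> carrier_mat n n" and W: "psd_mat W" "W \<in> carrier_mat n n"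
    and ab: "0 \<le> a" "0 \<le> b"
  shows "psd_mat (comb a b V W)"
proof -
  note c = comb_matrix[OF V(2) W(2)]
  have h: "herm n (comb a b V W)"
    unfolding comb_def by (intro herm_add herm_smult psd_herm V W)
  moreover have "0 \<le> Re (quad_form (comb a b V W) x)" if x: "x \<in> carrier_vec n" for x
  proof -
    have "quad_form (comb a b V W) x = of_real a * quad_form V x + of_real b * quad_form W x"
      unfolding quad_form_double[OF c(1) x] quad_form_double[OF V(2) x] quad_form_double[OF W(2) x]
      by (simp add: c sum_distrib_left distrib_right sum.distrib mult.assoc)
    moreover have "0 \<le> Re (quad_form V x)" "0 \<le> Re (quad_form W x)"
      using V W x by (auto simp: psd_mat_def)
    ultimately show ?thesis using ab by simp
  qed
  ultimately show ?thesis using c(1)[of a b] by (auto simp: psd_mat_def herm_def)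
qed

lemma sdr_lhs_comb:
  assumes C: "C \<in> carrier_mat n n" and V: "V \<in> carrier_mat n n" and W: "W \<in> carrier_mat n n"
    and p: "p \<in> carrier_vec m" and q: "q \<in> carrier_vec m"
  shows "sdr_lhs C c (comb a b V W) (a \<cdot>\<^sub>v p + b \<cdot>\<^sub>v q) = a * sdr_lhs C c V p + b * sdr_lhs C c W q"
proof -
  have "mat_trace (C * comb a b V W) = of_real a * mat_trace (C * V) + of_real b * mat_trace (C * W)"
    unfolding trace_mult[OF C V] trace_mult[OF C W] trace_mult[OF C comb_matrix(1)[OF V W]]
    by (simp add: comb_matrix[OF V W] sum_distrib_left distrib_left sum.distrib mult_ac)
  moreover have "c \<bullet> (a \<cdot>\<^sub>v p + b \<cdot>\<^sub>v q) = a * (c \<bullet> p) + b * (c \<bullet> q)"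
    using p q by (auto simp: scalar_prod_def sum_distrib_left distrib_left sum.distrib mult_ac)
  ultimately show ?thesis by (simp add: sdr_lhs_def distrib_left)
qed

lemma sdr_feasible_comb:
  assumes V: "sdr_feasible G V p" and W: "sdr_feasible G W q" and ab: "0 \<le> a" "0 \<le> b" "a + b = 1"
  shows "sdr_feasible G (comb a b V W) (a \<cdot>\<^sub>v p + b \<cdot>\<^sub>v q)"
proof -
  have c: "V \<in> carrier_mat (NV G) (NV G)" "W \<in> carrier_mat (NV G) (NV G)" "psd_mat V" "psd_mat W"
    "p \<in> carrier_vec (ND G)" "q \<in> carrier_vec (ND G)"
    using V W by (auto simp: sdr_feasible_def)
  have "sdr_lhs C d (comb a b V W) (a \<cdot>\<^sub>v p + b \<cdot>\<^sub>v q) \<le> e"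
    if C: "(C, d, e) \<in> set (opf_constraints G)" for C d e
  proof -
    have "C \<in> carrier_mat (NV G) (NV G)" using opf_constraints_hermitian[OF C] by blast
    moreover have "a * sdr_lhs C d V p + b * sdr_lhs C d W q \<le> a * e + b * e"
      using V W C ab by (intro add_mono mult_left_mono) (auto simp: sdr_feasible_def)
    moreover have "a * e + b * e = e" using ab by (simp add: distrib_right[symmetric])
    ultimately show ?thesis using c by (simp add: sdr_lhs_comb)
  qed
  moreover have "psd_mat (comb a b V W)" using psd_comb[OF c(3,1,4,2)] ab by simp
  ultimately show ?thesis
    using c comb_matrix(1)[OF c(1,2)] by (auto simp: sdr_feasible_def psd_mat_def)
qed

section \<open>The rank-one competitor\<close>

lemma edge_orientation:
  assumes "valid_topology G"
  obtains u :: "nat \<Rightarrow> nat \<Rightarrow> complex"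
  where "\<And>k. k < NE G \<Longrightarrow> u (ac_src G k) (ac_dst G k) = U k \<and> u (ac_dst G k) (ac_src G k) = cnj (U k)"
proof -
  have inj: "k = l" if "k < NE G" "l < NE G" "ac_src G k = ac_src G l" "ac_dst G k = ac_dst G l" for k l
    using assms that unfolding valid_topology_def by auto
  have norev: False if "k < NE G" "l < NE G" "ac_src G k = ac_dst G l" "ac_dst G k = ac_src G l" for k l
    using assms that unfolding valid_topology_def by (cases "k = l") auto
  \<comment> \<open>\<open>tree_potential\<close> wants phases on ordered pairs of buses, not on
    branches. Absence of parallel branches makes \<open>K\<close> well defined; absence of
    antiparallel ones keeps the two cases of \<open>u\<close> apart.\<close>
  define K where "K x y = (THE k. k < NE G \<and> ac_src G k = x \<and> ac_dst G k = y)" for x y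
  have K: "K (ac_src G k) (ac_dst G k) = k" if "k < NE G" for k
    unfolding K_def using that inj by (intro the_equality) auto
  define u where "u x y = (if \<exists>k<NE G. ac_src G k = x \<and> ac_dst G k = y
    then U (K x y) else cnj (U (K y x)))" for x y
  have "u (ac_src G k) (ac_dst G k) = U k \<and> u (ac_dst G k) (ac_src G k) = cnj (U k)" if "k < NE G" for k
  proof -
    have "\<not> (\<exists>l<NE G. ac_src G l = ac_dst G k \<and> ac_dst G l = ac_src G k)"
      using norev[OF that] by metis
    then show ?thesis using that K[OF that] by (auto simp: u_def)
  qed
  then show thesis by (rule that)
qed

lemma edge_shift_to_rank_one:
  assumes grid: "valid_grid G" and V: "psd_mat V" "V \<in> carrier_mat (NV G) (NV G)"
  obtains v \<tau> where "v \<in> carrier_vec (NV G)" "edge_shift G \<tau> (outer v (conjugate v) - V)"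
proof -
  let ?s = "ac_src G" and ?d = "ac_dst G"
  have topo: "valid_topology G" using grid by (simp add: valid_grid_def)
  have ends: "?s k < NV G" "?d k < NV G" "?s k \<noteq> ?d k" if "k < NE G" for k
    using topo that by (auto simp: valid_topology_def)
  \<comment> \<open>The moduli of \<open>v\<close>, chosen to preserve the diagonal; the phases come
    from \<open>tree_potential\<close>.\<close>
  define r where "r n = sqrt (Re (V $$ (n, n)))" for n
  have "\<exists>t. k < NE G \<longrightarrow> 0 \<le> t \<and> cmod (V $$ (?s k, ?d k) + of_real t * rho G k) = r (?s k) * r (?d k)" for k
  proof (cases "k < NE G")
    case True
    have "rho G k \<noteq> 0"
      using grid True by (auto simp: valid_grid_def valid_branches_def rho_def)
    \<comment> \<open>The minor inequality says that the entry starts inside the circle to which it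
      is moved.\<close>
    moreover have "cmod (V $$ (?s k, ?d k)) \<le> r (?s k) * r (?d k)"
      unfolding r_def real_sqrt_mult[symmetric]
      by (rule real_le_rsqrt[OF psd_minor[OF V ends[OF True]]])
    ultimately show ?thesis by (metis ex_shift_norm_eq)
  qed simp
  then obtain \<tau> where \<tau>: "k < NE G \<Longrightarrow> 0 \<le> \<tau> k"
    "k < NE G \<Longrightarrow> cmod (V $$ (?s k, ?d k) + of_real (\<tau> k) * rho G k) = r (?s k) * r (?d k)" for k
    by metis
  define z where "z k = V $$ (?s k, ?d k) + of_real (\<tau> k) * rho G k" for k
  \<comment> \<open>If the target entry is 0, any phase will do, but \<open>tree_potential\<close>
    needs modulus 1.\<close>
  define U where "U k = (if z k = 0 then 1 else sgn (z k))" for k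
  have U: "cmod (U k) = 1" "z k = of_real (cmod (z k)) * U k" for k
    by (simp add: U_def norm_sgn) (simp add: U_def sgn_div_norm scaleR_conv_of_real)
  obtain u where u: "\<And>k. k < NE G \<Longrightarrow> u (?s k) (?d k) = U k \<and> u (?d k) (?s k) = cnj (U k)"
    using edge_orientation[OF topo] by metis
  obtain \<phi> where \<phi>: "\<And>x. cmod (\<phi> x) = 1" "\<And>x y. (x, y) \<in> ac_edges G \<Longrightarrow> \<phi> x * cnj (\<phi> y) = u x y"
  proof (rule tree_potential[of "{..<NV G}" "ac_edges G" u])
    show "tree_graph {..<NV G} (ac_edges G)" using topo by (simp add: valid_topology_def)
    show "ac_edges G \<subseteq> {..<NV G} \<times> {..<NV G}" "irrefl (ac_edges G)"
      using ends ends(3)[THEN not_sym] by (auto simp: ac_edges_def irrefl_def)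
    show "cmod (u x y) = 1" if "(x, y) \<in> ac_edges G" for x y
      using that u U(1) by (auto simp: ac_edges_def)
    show "(y, x) \<in> ac_edges G \<and> u y x = cnj (u x y)" if "(x, y) \<in> ac_edges G" for x y
      using that u by (auto simp: ac_edges_def)
  qed (use that in auto)
  define v where "v = vec (NV G) (\<lambda>n. of_real (r n) * \<phi> n)"
  have v: "v \<in> carrier_vec (NV G)" by (simp add: v_def)
  have "edge_shift G \<tau> (outer v (conjugate v) - V)"
  proof
    show "valid_grid G" by (fact grid)
    show "herm (NV G) (outer v (conjugate v) - V)"
      by (intro herm_minus psd_herm[OF psd_outer_conj[OF v] outer_conj(1)[OF v]] psd_herm[OF V])
    show "0 \<le> \<tau> k" if "k < NE G" for k by (rule \<tau>(1)[OF that])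
    show "(outer v (conjugate v) - V) $$ (n, n) = 0" if n: "n < NV G" for n
    proof -
      have "\<phi> n * cnj (\<phi> n) = 1" using \<phi>(1)[of n] by (simp add: complex_norm_square[symmetric])
      moreover have "of_real (r n) * of_real (r n) = V $$ (n, n)"
        using psd_diag[OF V n] unfolding r_def of_real_mult[symmetric] by simp
      moreover have "v $ n * cnj (v $ n) = of_real (r n) * of_real (r n) * (\<phi> n * cnj (\<phi> n))"
        using n by (simp add: v_def)
      ultimately show ?thesis using n V(2) outer_conj[OF v] by simp
    qed
    show "(outer v (conjugate v) - V) $$ (?s k, ?d k) = of_real (\<tau> k) * rho G k" if k: "k < NE G" for k
    proof -
      have "\<phi> (?s k) * cnj (\<phi> (?d k)) = U k"
        using \<phi>(2)[of "?s k" "?d k"] u[OF k] k by (auto simp: ac_edges_def)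
      moreover have "v $ ?s k * cnj (v $ ?d k)
          = of_real (r (?s k)) * of_real (r (?d k)) * (\<phi> (?s k) * cnj (\<phi> (?d k)))"
        using ends[OF k] by (simp add: v_def)
      ultimately have "v $ ?s k * cnj (v $ ?d k) = z k"
        using \<tau>(2)[OF k] U(2)[of k] by (simp add: z_def[symmetric])
      then show ?thesis using ends[OF k] V(2) outer_conj[OF v] by (simp add: z_def)
    qed
  qed
  with v show thesis by (rule that)
qed

lemma sdr_lhs_diff:
  assumes C: "C \<in> carrier_mat n n" and V: "V \<in> carrier_mat n n" and W: "W \<in> carrier_mat n n"
  shows "sdr_lhs C c W p = sdr_lhs C c V p + Re (mat_trace (C * (W - V)))"
proof -
  have "mat_trace (C * (W - V)) = mat_trace (C * W) - mat_trace (C * V)"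
    unfolding trace_mult[OF C V] trace_mult[OF C W] trace_mult[OF C minus_carrier_mat[OF V]]
    using V W by (simp add: right_diff_distrib sum_subtractf)
  then show ?thesis by (simp add: sdr_lhs_def)
qed

definition branch_gain :: "grid \<Rightarrow> nat \<Rightarrow> real" where
  "branch_gain G k = 2 * loss_weight G * (cmod (rho G k))\<^sup>2 * Re (y_series G k)"

lemma branch_gain_pos:
  assumes "valid_grid G" "k < NE G"
  shows "0 < branch_gain G k"
  using assms by (simp add: branch_gain_def valid_grid_def valid_branches_def valid_costs_def rho_def)

text \<open>The target modulus is expressed by the diagonal of \<open>V\<close> itself, so later
  arguments need only \<tau> and the objective and never the vector behind \<open>W\<close>.\<close>

lemma sdr_improvement:
  assumes grid: "valid_grid G" and feas: "sdr_feasible G V p"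
  obtains W \<tau> where "sdr_feasible G W p"
    "\<And>k. k < NE G \<Longrightarrow> 0 \<le> \<tau> k \<and>
      (cmod (V $$ (ac_src G k, ac_dst G k) + of_real (\<tau> k) * rho G k))\<^sup>2
        = Re (V $$ (ac_src G k, ac_src G k)) * Re (V $$ (ac_dst G k, ac_dst G k)) \<and>
      sdr_lhs (C0_mat G) (c0_vec G) W p \<le> sdr_lhs (C0_mat G) (c0_vec G) V p - branch_gain G k * \<tau> k"
proof -
  have V: "psd_mat V" "V \<in> carrier_mat (NV G) (NV G)" using feas by (auto simp: sdr_feasible_def)
  obtain v \<tau> where v: "v \<in> carrier_vec (NV G)" and sh: "edge_shift G \<tau> (outer v (conjugate v) - V)"
    using edge_shift_to_rank_one[OF grid V] by metis
  interpret edge_shift G \<tau> "outer v (conjugate v) - V" by (rule sh)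
  define W where "W = outer v (conjugate v)"
  have W: "W \<in> carrier_mat (NV G) (NV G)" "psd_mat W"
    unfolding W_def by (rule outer_conj(1)[OF v], rule psd_outer_conj[OF v])
  have Wij: "W $$ (i, j) = v $ i * cnj (v $ j)" if "i < NV G" "j < NV G" for i j
    unfolding W_def using outer_conj(2)[OF v that] .
  have "sdr_lhs C c W p \<le> b" if C: "(C, c, b) \<in> set (opf_constraints G)" for C c b
  proof -
    have "C \<in> carrier_mat (NV G) (NV G)" using opf_constraints_hermitian[OF C] by blast
    from sdr_lhs_diff[OF this V(2) W(1), of c p] show ?thesis
      using trace_constraint[OF C] feas C unfolding W_def[symmetric] sdr_feasible_def by fastforce
  qed
  then have "sdr_feasible G W p"
    using W feas by (auto simp: sdr_feasible_def psd_mat_def)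
  moreover have "0 \<le> \<tau> k \<and>
      (cmod (V $$ (ac_src G k, ac_dst G k) + of_real (\<tau> k) * rho G k))\<^sup>2
        = Re (V $$ (ac_src G k, ac_src G k)) * Re (V $$ (ac_dst G k, ac_dst G k)) \<and>
      sdr_lhs (C0_mat G) (c0_vec G) W p \<le> sdr_lhs (C0_mat G) (c0_vec G) V p - branch_gain G k * \<tau> k"
    if k: "k < NE G" for k
  proof (intro conjI)
    show "0 \<le> \<tau> k" by (rule nonneg[OF k])
    have d: "Re (V $$ (n, n)) = (cmod (v $ n))\<^sup>2" if "n < NV G" for n
    proof -
      have "V $$ (n, n) = v $ n * cnj (v $ n)" using diag[OF that] V(2) W(1) that Wij by (simp add: W_def)
      then show ?thesis by (simp add: complex_norm_square[symmetric] del: of_real_power)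
    qed
    have "V $$ (ac_src G k, ac_dst G k) + of_real (\<tau> k) * rho G k = v $ ac_src G k * cnj (v $ ac_dst G k)"
      using edge[OF k] ends[OF k] V(2) Wij by (simp add: W_def[symmetric] algebra_simps)
    then show "(cmod (V $$ (ac_src G k, ac_dst G k) + of_real (\<tau> k) * rho G k))\<^sup>2
        = Re (V $$ (ac_src G k, ac_src G k)) * Re (V $$ (ac_dst G k, ac_dst G k))"
      using ends[OF k] by (simp add: d norm_mult power_mult_distrib)
    show "sdr_lhs (C0_mat G) (c0_vec G) W p \<le> sdr_lhs (C0_mat G) (c0_vec G) V p - branch_gain G k * \<tau> k"
      using sdr_lhs_diff[OF _ V(2) W(1), of "C0_mat G" "c0_vec G" p] C0_hermitian[of G]
        trace_objective[OF k]
      by (simp add: W_def branch_gain_def)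
  qed
  ultimately show thesis by (rule that)
qed

section \<open>Optimizers\<close>

text \<open>Positivity of the diagonal comes from the strict lower voltage bound: the squared
  voltage exceeds the square of \<open>V_lo\<close>, hence 0.\<close>

lemma strictly_feasible_sdr:
  assumes "opf_strictly_feasible G"
  obtains V p where "sdr_feasible G V p" "\<And>n. n < NV G \<Longrightarrow> 0 < Re (V $$ (n, n))"
proof -
  obtain v p where v: "v \<in> carrier_vec (NV G)" and p: "p \<in> carrier_vec (ND G)"
    and ac: "\<And>C c b. (C, c, b) \<in> set (ac_constraints G) \<Longrightarrow> opf_lhs C c v p < b"
    and dc: "\<And>C c b. (C, c, b) \<in> set (dc_constraints G) \<Longrightarrow> opf_lhs C c v p \<le> b"
    using assms unfolding opf_strictly_feasible_def by fast
  define V where "V = outer v (conjugate v)"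
  have V: "V \<in> carrier_mat (NV G) (NV G)" "psd_mat V"
    unfolding V_def by (rule outer_conj(1)[OF v], rule psd_outer_conj[OF v])
  have eq: "opf_lhs C c v p = sdr_lhs C c V p" if "(C, c, b) \<in> set (opf_constraints G)" for C c b
    unfolding V_def using opf_constraints_hermitian[OF that] by (intro opf_lhs_eq_sdr_lhs[OF _ v]) simp
  have "sdr_lhs C c V p \<le> b" if "(C, c, b) \<in> set (opf_constraints G)" for C c b
    using that ac[of C c b] dc[of C c b] eq[OF that] by (auto simp: opf_constraints_def)
  then have "sdr_feasible G V p"
    using V p by (auto simp: sdr_feasible_def psd_mat_def)
  moreover have "0 < Re (V $$ (n, n))" if n: "n < NV G" for n
  proof -
    have in_ac: "(- M_mat G n, 0\<^sub>v (ND G), - (V_lo G n)\<^sup>2) \<in> set (ac_constraints G)"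
      using n by (auto simp: ac_constraints_def)
    have "mat_trace (- M_mat G n * V) = - V $$ (n, n)"
      using trace_uminus_mult[OF hermD(1)[OF herm_M_mat] V(1)] trace_outer_unit_mult[OF V(1) n n]
      by (simp add: M_mat_def del: uminus_mult_left_mat)
    then have "sdr_lhs (- M_mat G n) (0\<^sub>v (ND G)) V p = - Re (V $$ (n, n))"
      using p by (simp add: sdr_lhs_def del: uminus_mult_left_mat)
    moreover have "sdr_lhs (- M_mat G n) (0\<^sub>v (ND G)) V p < - (V_lo G n)\<^sup>2"
      using ac[OF in_ac] eq[of "- M_mat G n" "0\<^sub>v (ND G)" "- (V_lo G n)\<^sup>2"] in_ac by (simp add: opf_constraints_def)
    moreover have "0 \<le> (V_lo G n)\<^sup>2" by simp
    ultimately show ?thesis by linarith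
  qed
  ultimately show thesis by (rule that)
qed

lemma optimizer_tight:
  assumes grid: "valid_grid G" and opt: "sdr_optimizer G V p" and k: "k < NE G"
  shows "(cmod (V $$ (ac_src G k, ac_dst G k)))\<^sup>2
    = Re (V $$ (ac_src G k, ac_src G k)) * Re (V $$ (ac_dst G k, ac_dst G k))"
proof -
  have feas: "sdr_feasible G V p" using opt by (simp add: sdr_optimizer_def)
  obtain W \<tau> where W: "sdr_feasible G W p" and "0 \<le> \<tau> k"
    and eq: "(cmod (V $$ (ac_src G k, ac_dst G k) + of_real (\<tau> k) * rho G k))\<^sup>2
        = Re (V $$ (ac_src G k, ac_src G k)) * Re (V $$ (ac_dst G k, ac_dst G k))"
    and "sdr_lhs (C0_mat G) (c0_vec G) W p \<le> sdr_lhs (C0_mat G) (c0_vec G) V p - branch_gain G k * \<tau> k"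
    using sdr_improvement[OF grid feas] k by metis
  moreover have "sdr_lhs (C0_mat G) (c0_vec G) V p \<le> sdr_lhs (C0_mat G) (c0_vec G) W p"
    using opt W by (simp add: sdr_optimizer_def)
  ultimately have "branch_gain G k * \<tau> k \<le> 0" by linarith
  then have "\<tau> k = 0"
    using branch_gain_pos[OF grid k] \<open>0 \<le> \<tau> k\<close> by (simp add: mult_le_0_iff)
  then show ?thesis using eq by simp
qed

text \<open>If exactly one end of a branch had voltage 0, mixing in a weight \<open>t\<close> of a feasible point with
  positive diagonal would cost \<open>O(t)\<close>, but make room for an edge entry of order \<open>\<surd>t\<close>.\<close>

lemma optimizer_diag_positive_edge:
  assumes grid: "valid_grid G" and strict: "opf_strictly_feasible G"
    and opt: "sdr_optimizer G V p" and k: "k < NE G"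
    and pos: "0 < Re (V $$ (ac_src G k, ac_src G k)) \<or> 0 < Re (V $$ (ac_dst G k, ac_dst G k))"
  shows "0 < Re (V $$ (ac_src G k, ac_src G k)) \<and> 0 < Re (V $$ (ac_dst G k, ac_dst G k))"
proof (rule ccontr)
  define s d where "s = ac_src G k" and "d = ac_dst G k"
  have sd: "s < NV G" "d < NV G" using grid k by (auto simp: s_def d_def valid_grid_def valid_topology_def)
  have feas: "sdr_feasible G V p" using opt by (simp add: sdr_optimizer_def)
  then have V: "psd_mat V" "V \<in> carrier_mat (NV G) (NV G)" and p: "p \<in> carrier_vec (ND G)"
    by (auto simp: sdr_feasible_def)
  obtain V0 p0 where feas0: "sdr_feasible G V0 p0" and pos0: "\<And>n. n < NV G \<Longrightarrow> 0 < Re (V0 $$ (n, n))"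
    using strictly_feasible_sdr[OF strict] by metis
  then have V0: "V0 \<in> carrier_mat (NV G) (NV G)" and p0: "p0 \<in> carrier_vec (ND G)"
    by (auto simp: sdr_feasible_def)
  define vs vd where "vs = Re (V $$ (s, s))" and "vd = Re (V $$ (d, d))"
  define as ad where "as = Re (V0 $$ (s, s))" and "ad = Re (V0 $$ (d, d))"
  have nn: "0 \<le> vs" "0 \<le> vd" "0 < as" "0 < ad"
    using psd_diag(2)[OF V] pos0 sd by (auto simp: vs_def vd_def as_def ad_def)
  assume "\<not> ?thesis"
  then have prod: "vs * vd = 0" using nn by (auto simp: vs_def vd_def s_def d_def)
  have "0 < vs \<or> 0 < vd" using pos by (simp add: vs_def vd_def s_def d_def)
  then have c: "0 < vs * ad + vd * as"
    using nn by (auto intro: add_pos_nonneg add_nonneg_pos)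
  have "(cmod (V $$ (s, d)))\<^sup>2 = vs * vd"
    using optimizer_tight[OF grid opt k] by (simp add: vs_def vd_def s_def d_def)
  \<comment> \<open>So the mixed entry below comes from \<open>V0\<close> alone and is of order
    \<open>t\<close>.\<close>
  then have Vsd: "V $$ (s, d) = 0" using prod by simp
  let ?f = "sdr_lhs (C0_mat G) (c0_vec G)"
  define g where "g = branch_gain G k"
  have g: "0 < g" unfolding g_def by (rule branch_gain_pos[OF grid k])
  \<comment> \<open>\<open>t * L\<close> bounds the modulus of the shifted mixed entry: the first
    term is the entry of \<open>V0\<close>, the second the largest shift that optimality of
    \<open>V\<close> permits.\<close>
  define L where "L = cmod (V0 $$ (s, d)) + (?f V0 p0 - ?f V p) / g * cmod (rho G k)"
  have bound: "(vs * ad + vd * as) / 2 \<le> t * L\<^sup>2" if t: "0 < t" "t \<le> 1 / 2" for t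
  proof -
    let ?V = "comb (1 - t) t V V0" and ?p = "(1 - t) \<cdot>\<^sub>v p + t \<cdot>\<^sub>v p0"
    have "sdr_feasible G ?V ?p" using sdr_feasible_comb[OF feas feas0] t by simp
    then obtain W \<tau> where W: "sdr_feasible G W ?p" and \<tau>: "0 \<le> \<tau> k"
      and eq: "(cmod (?V $$ (s, d) + of_real (\<tau> k) * rho G k))\<^sup>2 = Re (?V $$ (s, s)) * Re (?V $$ (d, d))"
      and le: "?f W ?p \<le> ?f ?V ?p - g * \<tau> k"
      using sdr_improvement[OF grid] k unfolding s_def d_def g_def by metis
    have "?f V p \<le> ?f W ?p" using opt W by (simp add: sdr_optimizer_def)
    moreover have "?f ?V ?p = (1 - t) * ?f V p + t * ?f V0 p0"
      using C0_hermitian V(2) V0 p p0 by (intro sdr_lhs_comb) auto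
    ultimately have "g * \<tau> k \<le> t * (?f V0 p0 - ?f V p)" using le by (simp add: algebra_simps)
    then have \<tau>_le: "\<tau> k \<le> t * ((?f V0 p0 - ?f V p) / g)"
      using g by (simp add: pos_le_divide_eq mult.commute)
    note e = comb_matrix(2)[OF V(2) V0]
    have "cmod (?V $$ (s, d) + of_real (\<tau> k) * rho G k) \<le> cmod (?V $$ (s, d)) + cmod (of_real (\<tau> k) * rho G k)"
      by (rule norm_triangle_ineq)
    also have "\<dots> = t * cmod (V0 $$ (s, d)) + \<tau> k * cmod (rho G k)"
      using e sd Vsd t \<tau> by (simp add: norm_mult)
    also have "\<dots> \<le> t * cmod (V0 $$ (s, d)) + t * ((?f V0 p0 - ?f V p) / g) * cmod (rho G k)"
      using \<tau>_le by (intro add_left_mono mult_right_mono) auto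
    also have "\<dots> = t * L" by (simp add: L_def distrib_left)
    finally have "cmod (?V $$ (s, d) + of_real (\<tau> k) * rho G k) \<le> t * L" .
    then have "(cmod (?V $$ (s, d) + of_real (\<tau> k) * rho G k))\<^sup>2 \<le> (t * L)\<^sup>2"
      by (intro power_mono) auto
    then have "((1 - t) * vs + t * as) * ((1 - t) * vd + t * ad) \<le> (t * L)\<^sup>2"
      unfolding eq using e sd by (simp add: vs_def vd_def as_def ad_def)
    \<comment> \<open>The product of the mixed diagonal entries has no constant term because
      \<open>vs * vd = 0\<close>, but its term of first order in \<open>t\<close> is positive; it
      cannot stay below \<open>(t * L)\<close>-squared.\<close>
    moreover have "((1 - t) * vs + t * as) * ((1 - t) * vd + t * ad)
        = (1 - t)\<^sup>2 * (vs * vd) + t * (1 - t) * (vs * ad + vd * as) + t\<^sup>2 * (as * ad)"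
      by (simp add: power2_eq_square algebra_simps)
    moreover have "0 \<le> t\<^sup>2 * (as * ad)" using nn by simp
    ultimately have "t * (1 - t) * (vs * ad + vd * as) \<le> (t * L)\<^sup>2"
      unfolding prod by linarith
    then have "t * ((1 - t) * (vs * ad + vd * as)) \<le> t * (t * L\<^sup>2)"
      by (simp add: power_mult_distrib power2_eq_square mult_ac)
    then have "(1 - t) * (vs * ad + vd * as) \<le> t * L\<^sup>2" using t by simp
    moreover have "1 / 2 * (vs * ad + vd * as) \<le> (1 - t) * (vs * ad + vd * as)"
      using t c by (intro mult_right_mono) auto
    ultimately show ?thesis by linarith
  qed
  define c' where "c' = vs * ad + vd * as"
  \<comment> \<open>Makes \<open>t * (L\<^sup>2 + 1)\<close> at most \<open>c' / 4\<close>, against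
    the lower bound \<open>c' / 2\<close>; adding 1 covers \<open>L = 0\<close>.\<close>
  define t where "t = min (1 / 2) (c' / (4 * (L\<^sup>2 + 1)))"
  have L1: "0 < L\<^sup>2 + 1" using zero_le_power2[of L] by linarith
  have t: "0 < t" "t \<le> 1 / 2" "t \<le> c' / (4 * (L\<^sup>2 + 1))"
    using c L1 unfolding t_def c'_def[symmetric]
    by (simp_all only: min_less_iff_conj min.cobounded1 min.cobounded2) simp
  have "c' / 2 \<le> t * L\<^sup>2" using bound[OF t(1,2)] by (simp add: c'_def)
  also have "\<dots> \<le> t * (L\<^sup>2 + 1)" using t by simp
  also have "\<dots> \<le> c' / 4" using t(3) L1 by (simp add: field_simps)
  finally show False using c unfolding c'_def[symmetric] by simp
qed

lemma rtrancl_preserves: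
  assumes "(x, y) \<in> R\<^sup>*" "P x" "\<And>a b. (a, b) \<in> R \<Longrightarrow> P a \<Longrightarrow> P b"
  shows "P y"
  using assms(1) by induction (use assms(2,3) in blast)+

theorem mainTheorem1:
  fixes G :: grid
  assumes "valid_grid G"
    and "opf_strictly_feasible G"
    and "\<nexists>p. sdr_feasible G (0\<^sub>m (NV G) (NV G)) p"
  shows "sdr_exact G"
  unfolding sdr_exact_def
proof (intro allI impI)
  fix V p assume opt: "sdr_optimizer G V p"
  let ?N = "NV G"
  have feas: "sdr_feasible G V p" using opt by (simp add: sdr_optimizer_def)
  then have V: "psd_mat V" "V \<in> carrier_mat ?N ?N" by (auto simp: sdr_feasible_def)
  have nz: "V \<noteq> 0\<^sub>m ?N ?N" using feas assms(3) by blast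
  have topo: "valid_topology G" using assms(1) by (simp add: valid_grid_def)
  then have ends: "ac_src G k < ?N" "ac_dst G k < ?N" "ac_src G k \<noteq> ac_dst G k" if "k < NE G" for k
    using that by (auto simp: valid_topology_def)
  have conn: "(x, y) \<in> (ac_edges G)\<^sup>*" if "x < ?N" "y < ?N" for x y
    using topo that by (simp add: valid_topology_def tree_graph_def connected_graph_def)
  have edge: "x < ?N" "y < ?N" "x \<noteq> y"
    "(cmod (V $$ (x, y)))\<^sup>2 = Re (V $$ (x, x)) * Re (V $$ (y, y))"
    "0 < Re (V $$ (x, x)) \<Longrightarrow> 0 < Re (V $$ (y, y))" if xy: "(x, y) \<in> ac_edges G" for x y
  proof -
    obtain k where k: "k < NE G" and o: "x = ac_src G k \<and> y = ac_dst G k \<or> x = ac_dst G k \<and> y = ac_src G k"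
      using xy by (auto simp: ac_edges_def)
    show lt: "x < ?N" "y < ?N" "x \<noteq> y" using ends[OF k] o by auto
    have "cmod (V $$ (y, x)) = cmod (V $$ (x, y))"
      using hermD(4)[OF psd_herm[OF V] lt(1,2)] by (metis complex_mod_cnj)
    then show "(cmod (V $$ (x, y)))\<^sup>2 = Re (V $$ (x, x)) * Re (V $$ (y, y))"
      using optimizer_tight[OF assms(1) opt k] o by (auto simp: mult.commute)
    show "0 < Re (V $$ (y, y))" if "0 < Re (V $$ (x, x))"
      using optimizer_diag_positive_edge[OF assms(1,2) opt k] o that by auto
  qed
  \<comment> \<open>With a zero diagonal, \<open>psd_minor\<close> would make every entry vanish,
    but \<open>V\<close> = 0 is infeasible by assumption.\<close>
  have "\<exists>r<?N. 0 < Re (V $$ (r, r))"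
  proof (rule ccontr)
    assume "\<not> (\<exists>r<?N. 0 < Re (V $$ (r, r)))"
    then have 0: "Re (V $$ (r, r)) = 0" if "r < ?N" for r
      using psd_diag(2)[OF V that] that by fastforce
    have "V $$ (i, j) = 0" if "i < ?N" "j < ?N" for i j
    proof (cases "i = j")
      case True
      then show ?thesis using psd_diag(1)[OF V that(1)] 0[OF that(1)] by simp
    next
      case False
      then show ?thesis using psd_minor[OF V that False] 0[OF that(1)] by simp
    qed
    then show False using nz V(2) by (auto simp: mat_eq_iff)
  qed
  then obtain r where r: "r < ?N" "0 < Re (V $$ (r, r))" by blast
  have pos: "0 < Re (V $$ (j, j))" if "j < ?N" for j
    using rtrancl_preserves[OF conn[OF r(1) that], of "\<lambda>j. 0 < Re (V $$ (j, j))"] r(2) edge(5) by blast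
  \<comment> \<open>Column \<open>r\<close> serves as reference; proportionality to it spreads along
    paths of the tree, which yields the factorization of \<open>V\<close> needed for rank
    one.\<close>
  have "\<exists>c. \<forall>i<?N. V $$ (i, j) = V $$ (i, r) * c" if "j < ?N" for j
  proof (rule rtrancl_preserves[OF conn[OF r(1) that], of "\<lambda>j. \<exists>c. \<forall>i<?N. V $$ (i, j) = V $$ (i, r) * c"])
    show "\<exists>c. \<forall>i<?N. V $$ (i, r) = V $$ (i, r) * c" by (rule exI[of _ 1]) simp
    fix a b assume ab: "(a, b) \<in> ac_edges G" and "\<exists>c. \<forall>i<?N. V $$ (i, a) = V $$ (i, r) * c"
    then obtain c where c: "\<forall>i<?N. V $$ (i, a) = V $$ (i, r) * c" by blast
    note e = edge[OF ab]
    \<comment> \<open>The minor is taken in the order (b, a), so that the column relation can be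
      divided by the positive entry at (a, a), where column \<open>a\<close> is already
      known.\<close>
    have ba: "(cmod (V $$ (b, a)))\<^sup>2 = Re (V $$ (b, b)) * Re (V $$ (a, a))"
      using edge(4)[of b a] ab by (auto simp: ac_edges_def)
    have nza: "V $$ (a, a) \<noteq> 0" using pos[OF e(1)] by auto
    have "V $$ (i, b) = V $$ (i, r) * (c * V $$ (a, b) / V $$ (a, a))" if "i < ?N" for i
      using psd_tight_minor_columns[OF V e(2,1) e(3)[symmetric] that ba] c that nza
      by (simp add: field_simps)
    then show "\<exists>c. \<forall>i<?N. V $$ (i, b) = V $$ (i, r) * c" by blast
  qed
  then obtain c where "\<And>i j. i < ?N \<Longrightarrow> j < ?N \<Longrightarrow> V $$ (i, j) = V $$ (i, r) * c j" by metis
  then show "vec_space.rank ?N V = 1" by (rule rank_eq_1I[OF V(2) nz])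
qed

end
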